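(* Let $\Psi$ be a class of $\mathcal F$-weights. The forgetful functor $(-)_\lambda \colon \Psi\text{-}\mathrm{SK}_0 \to \Psi_\lambda\text{-}\mathrm{SK}_0$ admits a coreflective left adjoint $(-)^\Psi \colon \Psi_\lambda\text{-}\mathrm{SK}_0 \to \Psi\text{-}\mathrm{SK}_0$ (i.e. a fully faithful left adjoint).
   Context: **$\mathcal F$-categories.** $\mathcal F$ is the full subcategory of the arrow category $\mathrm{CAT}^{\to}$ of the category of small categories spanned by the full embeddings $A\colon A_\tau \to A_\lambda$ (fully faithful, injective-on-objects functors); it is complete, cocomplete and cartesian closed. An $\mathcal F$-category $\mathbb C$ is a category enriched in $\mathcal F$; equivalently, a 2-category $\mathbb C_\lambda$, whose 1-cells are called loose morphisms, with a wide, locally full sub-2-category $\mathbb C_\tau$, whose 1-cells are called tight. An $\mathcal F$-functor is a 2-functor $\mathbb C_\lambda\to\mathbb D_\lambda$ preserving tightness. $\mathcal F$ itself is an $\mathcal F$-category $\mathbb F$: loose morphisms $A\to B$ are functors $A_\lambda\to B_\lambda$, the tight ones are those restricting to $A_\tau \to B_\tau$, 2-cells are natural transformations. **Weights and sketches.** Let $\mathcal V$ be $\mathrm{CAT}$ or $\mathcal F$. A $\mathcal V$-weight is a $\mathcal V$-functor $W\colon\mathscr J\to\mathcal V$ with $\mathscr J$ small. A $W$-weighted cone in a $\mathcal V$-category $\mathscr S$ over $D\colon\mathscr J\to\mathscr S$ is an object $X$ with a $\mathcal V$-natural transformation $\gamma\colon W\Rightarrow\mathscr S(X,D-)$. A (limit)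 $\mathcal V$-sketch is a small $\mathcal V$-category with a class of weighted cones (each consisting of $W,D,X,\gamma$); a morphism is a $\mathcal V$-functor sending each specified cone to a specified cone (with the same weight). A 2-sketch is a $\mathrm{CAT}$-sketch. For a class $\Psi$ of weights, a $\Psi$-limit sketch is one all of whose weights belong to $\Psi$; $\Psi\text{-}\mathrm{SK}_0$ denotes the category of $\Psi$-limit sketches and their morphisms. **Loose parts.** An $\mathcal F$-weight $W\colon\mathbb J\to\mathbb F$ has a loose part $W_\lambda\colon\mathbb J_\lambda\to\mathrm{CAT}$, $J\mapsto W(J)_\lambda$; a $W$-weighted cone $\gamma\colon W\Rightarrow\mathbb S(X,D-)$ has a loose part $\gamma_\lambda\colon W_\lambda\Rightarrow\mathbb S_\lambda(X,D_\lambda-)$. Let $\Psi_\lambda=\{W_\lambda\mid W\in\Psi\}$. The forgetful functor $(-)_\lambda$ sends a $\Psi$-limit $\mathcal F$-sketch $\mathcal S$ on $\mathbb S$ to the 2-sketch on $\mathbb S_\lambda$ whose specified cones are the loose parts of the specified cones of $\mathcal S$.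
   Formalization: If two distinct weights in Ψ share a loose part, no left adjoint exists for the plain set Ψ_λ. The result is proved for Ψ_λ as the family (W_λ) indexed by Ψ, for every Ψ, and for the plain set when W ↦ W_λ is injective on Ψ. *)

theory Defs
  imports "HOL-Library.FuncSet"
begin

text \<open>
  Smallness: everything small (the categories that are objects of CAT and F, shapes of weights,
  bases of sketches) has its objects and cells in one arbitrary type \<open>'u\<close>, which plays the role
  of the universe of small sets. CAT and the F-category F live over larger types built from
  \<open>'u\<close>, and classes of weights and of cones are arbitrary sets.

  All structure maps are required to be \<open>undefined\<close> outside their domain, so that HOL equality of
  the records below is equality of the mathematical structures.
\<close>

section \<open>Categories, functors, natural transformations\<close>

record ('o, 'a) cat =
  Ob :: "'o set"
  Ar :: "'a set"
  Src :: "'a \<Rightarrow> 'o"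
  Tgt :: "'a \<Rightarrow> 'o"
  Ident :: "'o \<Rightarrow> 'a"
  Cmp :: "'a \<Rightarrow> 'a \<Rightarrow> 'a"   \<comment> \<open>\<open>Cmp C g f\<close> is \<open>g\<close> after \<open>f\<close>\<close>

definition hom :: "('o, 'a) cat \<Rightarrow> 'o \<Rightarrow> 'o \<Rightarrow> 'a set" where
  "hom C x y = {f \<in> Ar C. Src C f = x \<and> Tgt C f = y}"

definition is_category :: "('o, 'a) cat \<Rightarrow> bool" where
  "is_category C \<longleftrightarrow>
     Src C \<in> Ar C \<rightarrow>\<^sub>E Ob C \<and> Tgt C \<in> Ar C \<rightarrow>\<^sub>E Ob C \<and> Ident C \<in> extensional (Ob C) \<and>
     (\<forall>x\<in>Ob C. Ident C x \<in> hom C x x) \<and>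
     (\<forall>f\<in>Ar C. \<forall>g\<in>Ar C. Tgt C f = Src C g \<longrightarrow> Cmp C g f \<in> hom C (Src C f) (Tgt C g)) \<and>
     (\<forall>f g. \<not> (f \<in> Ar C \<and> g \<in> Ar C \<and> Tgt C f = Src C g) \<longrightarrow> Cmp C g f = undefined) \<and>
     (\<forall>f\<in>Ar C. Cmp C f (Ident C (Src C f)) = f \<and> Cmp C (Ident C (Tgt C f)) f = f) \<and>
     (\<forall>f\<in>Ar C. \<forall>g\<in>Ar C. \<forall>h\<in>Ar C. Tgt C f = Src C g \<longrightarrow> Tgt C g = Src C h \<longrightarrow>
        Cmp C h (Cmp C g f) = Cmp C (Cmp C h g) f)"

record ('o, 'a, 'p, 'b) ftr =
  fob :: "'o \<Rightarrow> 'p"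
  far :: "'a \<Rightarrow> 'b"

definition is_functor :: "('o, 'a) cat \<Rightarrow> ('p, 'b) cat \<Rightarrow> ('o, 'a, 'p, 'b) ftr \<Rightarrow> bool" where
  "is_functor A B F \<longleftrightarrow>
     is_category A \<and> is_category B \<and>
     fob F \<in> Ob A \<rightarrow>\<^sub>E Ob B \<and> far F \<in> Ar A \<rightarrow>\<^sub>E Ar B \<and>
     (\<forall>f\<in>Ar A. Src B (far F f) = fob F (Src A f) \<and> Tgt B (far F f) = fob F (Tgt A f)) \<and>
     (\<forall>x\<in>Ob A. far F (Ident A x) = Ident B (fob F x)) \<and>
     (\<forall>f\<in>Ar A. \<forall>g\<in>Ar A. Tgt A f = Src A g \<longrightarrow> far F (Cmp A g f) = Cmp B (far F g) (far F f))"

definition id_ftr :: "('o, 'a) cat \<Rightarrow> ('o, 'a, 'o, 'a) ftr" where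
  "id_ftr A = \<lparr>fob = (\<lambda>x\<in>Ob A. x), far = (\<lambda>f\<in>Ar A. f)\<rparr>"

text \<open>\<open>comp_ftr A G F\<close> is \<open>G\<close> after \<open>F\<close>, where \<open>A\<close> is the domain of \<open>F\<close>.\<close>

definition comp_ftr ::
  "('o, 'a) cat \<Rightarrow> ('p, 'b, 'q, 'c) ftr \<Rightarrow> ('o, 'a, 'p, 'b) ftr \<Rightarrow> ('o, 'a, 'q, 'c) ftr" where
  "comp_ftr A G F = \<lparr>fob = (\<lambda>x\<in>Ob A. fob G (fob F x)), far = (\<lambda>f\<in>Ar A. far G (far F f))\<rparr>"

definition fully_faithful ::
  "('o, 'a) cat \<Rightarrow> ('p, 'b) cat \<Rightarrow> ('o, 'a, 'p, 'b) ftr \<Rightarrow> bool" where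
  "fully_faithful A B F \<longleftrightarrow>
     (\<forall>x\<in>Ob A. \<forall>y\<in>Ob A. bij_betw (far F) (hom A x y) (hom B (fob F x) (fob F y)))"

record ('o, 'a, 'p, 'b) ntr =
  ndom :: "('o, 'a, 'p, 'b) ftr"
  ncod :: "('o, 'a, 'p, 'b) ftr"
  ncmp :: "'o \<Rightarrow> 'b"

definition is_ntr :: "('o, 'a) cat \<Rightarrow> ('p, 'b) cat \<Rightarrow> ('o, 'a, 'p, 'b) ntr \<Rightarrow> bool" where
  "is_ntr A B t \<longleftrightarrow>
     is_functor A B (ndom t) \<and> is_functor A B (ncod t) \<and> ncmp t \<in> extensional (Ob A) \<and>
     (\<forall>x\<in>Ob A. ncmp t x \<in> hom B (fob (ndom t) x) (fob (ncod t) x)) \<and>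
     (\<forall>f\<in>Ar A. Cmp B (ncmp t (Tgt A f)) (far (ndom t) f) = Cmp B (far (ncod t) f) (ncmp t (Src A f)))"

definition functor_cat ::
  "('o, 'a) cat \<Rightarrow> ('p, 'b) cat \<Rightarrow> (('o, 'a, 'p, 'b) ftr, ('o, 'a, 'p, 'b) ntr) cat" where
  "functor_cat A B =
    \<lparr>Ob = {F. is_functor A B F},
     Ar = {t. is_ntr A B t},
     Src = (\<lambda>t\<in>{t. is_ntr A B t}. ndom t),
     Tgt = (\<lambda>t\<in>{t. is_ntr A B t}. ncod t),
     Ident = (\<lambda>F\<in>{F. is_functor A B F}.
        \<lparr>ndom = F, ncod = F, ncmp = (\<lambda>x\<in>Ob A. Ident B (fob F x))\<rparr>),
     Cmp = (\<lambda>s t. if is_ntr A B s \<and> is_ntr A B t \<and> ncod t = ndom s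
        then \<lparr>ndom = ndom t, ncod = ncod s, ncmp = (\<lambda>x\<in>Ob A. Cmp B (ncmp s x) (ncmp t x))\<rparr>
        else undefined)\<rparr>"

definition prod_cat :: "('o, 'a) cat \<Rightarrow> ('p, 'b) cat \<Rightarrow> ('o \<times> 'p, 'a \<times> 'b) cat" where
  "prod_cat A B =
    \<lparr>Ob = Ob A \<times> Ob B,
     Ar = Ar A \<times> Ar B,
     Src = (\<lambda>(f, g)\<in>Ar A \<times> Ar B. (Src A f, Src B g)),
     Tgt = (\<lambda>(f, g)\<in>Ar A \<times> Ar B. (Tgt A f, Tgt B g)),
     Ident = (\<lambda>(x, y)\<in>Ob A \<times> Ob B. (Ident A x, Ident B y)),
     Cmp = (\<lambda>(f', g') (f, g).
        if f \<in> Ar A \<and> g \<in> Ar B \<and> f' \<in> Ar A \<and> g' \<in> Ar B \<and> Tgt A f = Src A f' \<and> Tgt B g = Src B g'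
        then (Cmp A f' f, Cmp B g' g) else undefined)\<rparr>"

definition full_subcat :: "('o, 'a) cat \<Rightarrow> 'o set \<Rightarrow> ('o, 'a) cat" where
  "full_subcat C T =
    (let M = {f \<in> Ar C. Src C f \<in> T \<and> Tgt C f \<in> T} in
     \<lparr>Ob = T, Ar = M, Src = restrict (Src C) M, Tgt = restrict (Tgt C) M,
      Ident = restrict (Ident C) T,
      Cmp = (\<lambda>g f. if f \<in> M \<and> g \<in> M then Cmp C g f else undefined)\<rparr>)"

section \<open>2-categories\<close>

text \<open>
  A 2-category is given as a CAT-enriched category; \<open>HComp C X Y Z\<close> is the composition functor
  \<open>Hom Y Z \<times> Hom X Y \<rightarrow> Hom X Z\<close>, acting on 1-cells by \<open>fob\<close> and on 2-cells by \<open>far\<close>.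
\<close>

record ('o, 'm, 'a) two_cat =
  Obj :: "'o set"
  Hom :: "'o \<Rightarrow> 'o \<Rightarrow> ('m, 'a) cat"
  Unit :: "'o \<Rightarrow> 'm"
  HComp :: "'o \<Rightarrow> 'o \<Rightarrow> 'o \<Rightarrow> ('m \<times> 'm, 'a \<times> 'a, 'm, 'a) ftr"

abbreviation comp1 :: "('o, 'm, 'a) two_cat \<Rightarrow> 'o \<Rightarrow> 'o \<Rightarrow> 'o \<Rightarrow> 'm \<Rightarrow> 'm \<Rightarrow> 'm" where
  "comp1 C X Y Z g f \<equiv> fob (HComp C X Y Z) (g, f)"

abbreviation comp2 :: "('o, 'm, 'a) two_cat \<Rightarrow> 'o \<Rightarrow> 'o \<Rightarrow> 'o \<Rightarrow> 'a \<Rightarrow> 'a \<Rightarrow> 'a" where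
  "comp2 C X Y Z b a \<equiv> far (HComp C X Y Z) (b, a)"

definition is_two_cat :: "('o, 'm, 'a) two_cat \<Rightarrow> bool" where
  "is_two_cat C \<longleftrightarrow>
     (\<forall>X\<in>Obj C. \<forall>Y\<in>Obj C. is_category (Hom C X Y)) \<and>
     (\<forall>X Y. \<not> (X \<in> Obj C \<and> Y \<in> Obj C) \<longrightarrow> Hom C X Y = undefined) \<and>
     Unit C \<in> extensional (Obj C) \<and>
     (\<forall>X\<in>Obj C. Unit C X \<in> Ob (Hom C X X)) \<and>
     (\<forall>X\<in>Obj C. \<forall>Y\<in>Obj C. \<forall>Z\<in>Obj C.
        is_functor (prod_cat (Hom C Y Z) (Hom C X Y)) (Hom C X Z) (HComp C X Y Z)) \<and>
     (\<forall>X Y Z. \<not> (X \<in> Obj C \<and> Y \<in> Obj C \<and> Z \<in> Obj C) \<longrightarrow> HComp C X Y Z = undefined) \<and>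
     (\<forall>X\<in>Obj C. \<forall>Y\<in>Obj C.
        (\<forall>f\<in>Ob (Hom C X Y). comp1 C X X Y f (Unit C X) = f \<and> comp1 C X Y Y (Unit C Y) f = f) \<and>
        (\<forall>a\<in>Ar (Hom C X Y). comp2 C X X Y a (Ident (Hom C X X) (Unit C X)) = a \<and>
           comp2 C X Y Y (Ident (Hom C Y Y) (Unit C Y)) a = a)) \<and>
     (\<forall>X\<in>Obj C. \<forall>Y\<in>Obj C. \<forall>Z\<in>Obj C. \<forall>V\<in>Obj C.
        (\<forall>f\<in>Ob (Hom C X Y). \<forall>g\<in>Ob (Hom C Y Z). \<forall>h\<in>Ob (Hom C Z V).
           comp1 C X Z V h (comp1 C X Y Z g f) = comp1 C X Y V (comp1 C Y Z V h g) f) \<and>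
        (\<forall>a\<in>Ar (Hom C X Y). \<forall>b\<in>Ar (Hom C Y Z). \<forall>c\<in>Ar (Hom C Z V).
           comp2 C X Z V c (comp2 C X Y Z b a) = comp2 C X Y V (comp2 C Y Z V c b) a))"

text \<open>In the next two definitions the arguments \<open>A\<close> and \<open>B\<close> are understood to be 2-categories.\<close>

record ('o, 'm, 'a, 'p, 'n, 'b) two_ftr =
  tob :: "'o \<Rightarrow> 'p"
  thom :: "'o \<Rightarrow> 'o \<Rightarrow> ('m, 'a, 'n, 'b) ftr"

definition is_two_functor ::
  "('o, 'm, 'a) two_cat \<Rightarrow> ('p, 'n, 'b) two_cat \<Rightarrow> ('o, 'm, 'a, 'p, 'n, 'b) two_ftr \<Rightarrow> bool" where
  "is_two_functor A B F \<longleftrightarrow>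
     tob F \<in> Obj A \<rightarrow>\<^sub>E Obj B \<and>
     (\<forall>X\<in>Obj A. \<forall>Y\<in>Obj A. is_functor (Hom A X Y) (Hom B (tob F X) (tob F Y)) (thom F X Y)) \<and>
     (\<forall>X Y. \<not> (X \<in> Obj A \<and> Y \<in> Obj A) \<longrightarrow> thom F X Y = undefined) \<and>
     (\<forall>X\<in>Obj A. fob (thom F X X) (Unit A X) = Unit B (tob F X)) \<and>
     (\<forall>X\<in>Obj A. \<forall>Y\<in>Obj A. \<forall>Z\<in>Obj A.
        (\<forall>f\<in>Ob (Hom A X Y). \<forall>g\<in>Ob (Hom A Y Z).
           fob (thom F X Z) (comp1 A X Y Z g f) =
           comp1 B (tob F X) (tob F Y) (tob F Z) (fob (thom F Y Z) g) (fob (thom F X Y) f)) \<and>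
        (\<forall>a\<in>Ar (Hom A X Y). \<forall>b\<in>Ar (Hom A Y Z).
           far (thom F X Z) (comp2 A X Y Z b a) =
           comp2 B (tob F X) (tob F Y) (tob F Z) (far (thom F Y Z) b) (far (thom F X Y) a)))"

definition is_two_nat ::
  "('o, 'm, 'a) two_cat \<Rightarrow> ('p, 'n, 'b) two_cat \<Rightarrow>
   ('o, 'm, 'a, 'p, 'n, 'b) two_ftr \<Rightarrow> ('o, 'm, 'a, 'p, 'n, 'b) two_ftr \<Rightarrow> ('o \<Rightarrow> 'n) \<Rightarrow> bool" where
  "is_two_nat A B F G t \<longleftrightarrow>
     is_two_functor A B F \<and> is_two_functor A B G \<and>
     t \<in> extensional (Obj A) \<and>
     (\<forall>X\<in>Obj A. t X \<in> Ob (Hom B (tob F X) (tob G X))) \<and>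
     (\<forall>X\<in>Obj A. \<forall>Y\<in>Obj A.
        (\<forall>f\<in>Ob (Hom A X Y).
           comp1 B (tob F X) (tob F Y) (tob G Y) (t Y) (fob (thom F X Y) f) =
           comp1 B (tob F X) (tob G X) (tob G Y) (fob (thom G X Y) f) (t X)) \<and>
        (\<forall>a\<in>Ar (Hom A X Y).
           comp2 B (tob F X) (tob F Y) (tob G Y)
             (Ident (Hom B (tob F Y) (tob G Y)) (t Y)) (far (thom F X Y) a) =
           comp2 B (tob F X) (tob G X) (tob G Y)
             (far (thom G X Y) a) (Ident (Hom B (tob F X) (tob G X)) (t X))))"

definition id_two_ftr :: "('o, 'm, 'a) two_cat \<Rightarrow> ('o, 'm, 'a, 'o, 'm, 'a) two_ftr" where
  "id_two_ftr A = \<lparr>tob = (\<lambda>X\<in>Obj A. X),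
     thom = (\<lambda>X Y. if X \<in> Obj A \<and> Y \<in> Obj A then id_ftr (Hom A X Y) else undefined)\<rparr>"

definition comp_two_ftr ::
  "('o, 'm, 'a) two_cat \<Rightarrow> ('p, 'n, 'b, 'q, 'l, 'c) two_ftr \<Rightarrow>
   ('o, 'm, 'a, 'p, 'n, 'b) two_ftr \<Rightarrow> ('o, 'm, 'a, 'q, 'l, 'c) two_ftr" where
  "comp_two_ftr A G F = \<lparr>tob = (\<lambda>X\<in>Obj A. tob G (tob F X)),
     thom = (\<lambda>X Y. if X \<in> Obj A \<and> Y \<in> Obj A
        then comp_ftr (Hom A X Y) (thom G (tob F X) (tob F Y)) (thom F X Y) else undefined)\<rparr>"

text \<open>
  The 2-category with the given objects whose hom from \<open>A\<close> to \<open>B\<close> is the functor category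
  \<open>[L A, L B]\<close>. It gives CAT for \<open>L\<close> the identity and the loose part of the F-category F for
  \<open>L = (-)_\<lambda>\<close>.
\<close>

definition hcomp_functor ::
  "('o, 'a) cat \<Rightarrow> ('o, 'a) cat \<Rightarrow> ('o, 'a) cat \<Rightarrow>
   (('o, 'a, 'o, 'a) ftr \<times> ('o, 'a, 'o, 'a) ftr, ('o, 'a, 'o, 'a) ntr \<times> ('o, 'a, 'o, 'a) ntr,
    ('o, 'a, 'o, 'a) ftr, ('o, 'a, 'o, 'a) ntr) ftr" where
  "hcomp_functor A B C =
    \<lparr>fob = (\<lambda>(G, F)\<in>Ob (functor_cat B C) \<times> Ob (functor_cat A B). comp_ftr A G F),
     far = (\<lambda>(s, t)\<in>Ar (functor_cat B C) \<times> Ar (functor_cat A B).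
        \<lparr>ndom = comp_ftr A (ndom s) (ndom t),
         ncod = comp_ftr A (ncod s) (ncod t),
         ncmp = (\<lambda>x\<in>Ob A. Cmp C (ncmp s (fob (ncod t) x)) (far (ndom s) (ncmp t x)))\<rparr>)\<rparr>"

definition cat_over ::
  "'x set \<Rightarrow> ('x \<Rightarrow> ('o, 'a) cat) \<Rightarrow> ('x, ('o, 'a, 'o, 'a) ftr, ('o, 'a, 'o, 'a) ntr) two_cat" where
  "cat_over U L =
    \<lparr>Obj = U,
     Hom = (\<lambda>A B. if A \<in> U \<and> B \<in> U then functor_cat (L A) (L B) else undefined),
     Unit = (\<lambda>A\<in>U. id_ftr (L A)),
     HComp = (\<lambda>A B C. if A \<in> U \<and> B \<in> U \<and> C \<in> U
        then hcomp_functor (L A) (L B) (L C) else undefined)\<rparr>"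

type_synonym 'u scat = "('u, 'u) cat"
type_synonym 'u sftr = "('u, 'u, 'u, 'u) ftr"
type_synonym 'u sntr = "('u, 'u, 'u, 'u) ntr"
type_synonym 'u stwo_cat = "('u, 'u, 'u) two_cat"
type_synonym 'u stwo_ftr = "('u, 'u, 'u, 'u, 'u, 'u) two_ftr"

definition CAT :: "('u scat, 'u sftr, 'u sntr) two_cat" where
  "CAT = cat_over {A. is_category A} (\<lambda>A. A)"

text \<open>
  The functors \<open>S(Y, Z) \<rightarrow> [S(X, Y), S(X, Z)]\<close> given by postcomposition with 1- and 2-cells,
  and the representable 2-functor \<open>S(X, -)\<close>.
\<close>

definition postcomp1 :: "('o, 'm, 'a) two_cat \<Rightarrow> 'o \<Rightarrow> 'o \<Rightarrow> 'o \<Rightarrow> 'm \<Rightarrow> ('m, 'a, 'm, 'a) ftr" where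
  "postcomp1 S X Y Z f =
    \<lparr>fob = (\<lambda>g\<in>Ob (Hom S X Y). comp1 S X Y Z f g),
     far = (\<lambda>a\<in>Ar (Hom S X Y). comp2 S X Y Z (Ident (Hom S Y Z) f) a)\<rparr>"

definition postcomp ::
  "('o, 'm, 'a) two_cat \<Rightarrow> 'o \<Rightarrow> 'o \<Rightarrow> 'o \<Rightarrow> ('m, 'a, ('m, 'a, 'm, 'a) ftr, ('m, 'a, 'm, 'a) ntr) ftr"
where
  "postcomp S X Y Z =
    \<lparr>fob = (\<lambda>f\<in>Ob (Hom S Y Z). postcomp1 S X Y Z f),
     far = (\<lambda>b\<in>Ar (Hom S Y Z).
        \<lparr>ndom = postcomp1 S X Y Z (Src (Hom S Y Z) b),
         ncod = postcomp1 S X Y Z (Tgt (Hom S Y Z) b),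
         ncmp = (\<lambda>g\<in>Ob (Hom S X Y). comp2 S X Y Z b (Ident (Hom S X Y) g))\<rparr>)\<rparr>"

definition two_hom :: "'u stwo_cat \<Rightarrow> 'u \<Rightarrow> ('u, 'u, 'u, 'u scat, 'u sftr, 'u sntr) two_ftr" where
  "two_hom S X =
    \<lparr>tob = (\<lambda>Y\<in>Obj S. Hom S X Y),
     thom = (\<lambda>Y Z. if Y \<in> Obj S \<and> Z \<in> Obj S then postcomp S X Y Z else undefined)\<rparr>"

section \<open>F-categories\<close>

text \<open>Objects of F: full embeddings \<open>Emb : Tau \<rightarrow> Lam\<close> of small categories.\<close>

record 'u F_obj =
  Tau :: "'u scat"
  Lam :: "'u scat"
  Emb :: "'u sftr"

definition is_F_obj :: "'u F_obj \<Rightarrow> bool" where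
  "is_F_obj A \<longleftrightarrow> is_functor (Tau A) (Lam A) (Emb A) \<and>
     fully_faithful (Tau A) (Lam A) (Emb A) \<and> inj_on (fob (Emb A)) (Ob (Tau A))"

text \<open>
  An F-category is a 2-category with a wide, locally full sub-2-category, which is determined by
  its 1-cells \<open>Tight\<close>. F-functors and F-natural transformations are represented by their loose
  parts. The components of an F-natural transformation are morphisms \<open>1 \<rightarrow> B(F X, G X)\<close> in F,
  where the unit \<open>1\<close> is the identity on the terminal category, i.e. they are tight 1-cells.
\<close>

record ('o, 'm, 'a) F_cat =
  Loose :: "('o, 'm, 'a) two_cat"
  Tight :: "'o \<Rightarrow> 'o \<Rightarrow> 'm set"

definition is_F_cat :: "('o, 'm, 'a) F_cat \<Rightarrow> bool" where
  "is_F_cat C \<longleftrightarrow>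
     is_two_cat (Loose C) \<and>
     (\<forall>X\<in>Obj (Loose C). \<forall>Y\<in>Obj (Loose C). Tight C X Y \<subseteq> Ob (Hom (Loose C) X Y)) \<and>
     (\<forall>X Y. \<not> (X \<in> Obj (Loose C) \<and> Y \<in> Obj (Loose C)) \<longrightarrow> Tight C X Y = undefined) \<and>
     (\<forall>X\<in>Obj (Loose C). Unit (Loose C) X \<in> Tight C X X) \<and>
     (\<forall>X\<in>Obj (Loose C). \<forall>Y\<in>Obj (Loose C). \<forall>Z\<in>Obj (Loose C).
        \<forall>f\<in>Tight C X Y. \<forall>g\<in>Tight C Y Z. comp1 (Loose C) X Y Z g f \<in> Tight C X Z)"

definition is_F_functor ::
  "('o, 'm, 'a) F_cat \<Rightarrow> ('p, 'n, 'b) F_cat \<Rightarrow> ('o, 'm, 'a, 'p, 'n, 'b) two_ftr \<Rightarrow> bool" where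
  "is_F_functor A B F \<longleftrightarrow>
     is_two_functor (Loose A) (Loose B) F \<and>
     (\<forall>X\<in>Obj (Loose A). \<forall>Y\<in>Obj (Loose A). \<forall>f\<in>Tight A X Y.
        fob (thom F X Y) f \<in> Tight B (tob F X) (tob F Y))"

definition is_F_nat ::
  "('o, 'm, 'a) F_cat \<Rightarrow> ('p, 'n, 'b) F_cat \<Rightarrow>
   ('o, 'm, 'a, 'p, 'n, 'b) two_ftr \<Rightarrow> ('o, 'm, 'a, 'p, 'n, 'b) two_ftr \<Rightarrow> ('o \<Rightarrow> 'n) \<Rightarrow> bool" where
  "is_F_nat A B F G t \<longleftrightarrow>
     is_F_functor A B F \<and> is_F_functor A B G \<and> is_two_nat (Loose A) (Loose B) F G t \<and>
     (\<forall>X\<in>Obj (Loose A). t X \<in> Tight B (tob F X) (tob G X))"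

definition F_CAT :: "('u F_obj, 'u sftr, 'u sntr) F_cat" where
  "F_CAT =
    \<lparr>Loose = cat_over {A. is_F_obj A} Lam,
     Tight = (\<lambda>A B. if is_F_obj A \<and> is_F_obj B
        then {F. is_functor (Lam A) (Lam B) F \<and>
          (\<exists>G. is_functor (Tau A) (Tau B) G \<and>
             comp_ftr (Tau A) F (Emb A) = comp_ftr (Tau A) (Emb B) G)}
        else undefined)\<rparr>"

definition F_hom_obj :: "('u, 'u, 'u) F_cat \<Rightarrow> 'u \<Rightarrow> 'u \<Rightarrow> 'u F_obj" where
  "F_hom_obj S X Y =
    (let T = full_subcat (Hom (Loose S) X Y) (Tight S X Y) in
     \<lparr>Tau = T, Lam = Hom (Loose S) X Y, Emb = id_ftr T\<rparr>)"

definition F_hom :: "('u, 'u, 'u) F_cat \<Rightarrow> 'u \<Rightarrow> ('u, 'u, 'u, 'u F_obj, 'u sftr, 'u sntr) two_ftr" where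
  "F_hom S X =
    \<lparr>tob = (\<lambda>Y\<in>Obj (Loose S). F_hom_obj S X Y), thom = thom (two_hom (Loose S) X)\<rparr>"

section \<open>Weights and cones\<close>

type_synonym 'u sF_cat = "('u, 'u, 'u) F_cat"

record 'u two_weight =
  Shape :: "'u stwo_cat"
  Weight :: "('u, 'u, 'u, 'u scat, 'u sftr, 'u sntr) two_ftr"

record 'u F_weight =
  FShape :: "'u sF_cat"
  FWeight :: "('u, 'u, 'u, 'u F_obj, 'u sftr, 'u sntr) two_ftr"

definition is_two_weight :: "'u two_weight \<Rightarrow> bool" where
  "is_two_weight W \<longleftrightarrow> is_two_cat (Shape W) \<and> is_two_functor (Shape W) CAT (Weight W)"

definition is_F_weight :: "'u F_weight \<Rightarrow> bool" where
  "is_F_weight W \<longleftrightarrow> is_F_cat (FShape W) \<and> is_F_functor (FShape W) F_CAT (FWeight W)"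

definition loose_weight :: "'u F_weight \<Rightarrow> 'u two_weight" where
  "loose_weight W =
    \<lparr>Shape = Loose (FShape W),
     Weight = \<lparr>tob = (\<lambda>j\<in>Obj (Loose (FShape W)). Lam (tob (FWeight W) j)), thom = thom (FWeight W)\<rparr>\<rparr>"

text \<open>
  A cone consists of (an index for) its weight, the diagram \<open>D\<close>, the apex \<open>X\<close> and the transformation
  \<open>\<gamma> : W \<Rightarrow> S(X, D-)\<close>. For F-cones the index is the F-weight itself. For 2-cones the weight is
  \<open>w\<close> applied to the index, for a given family \<open>w\<close> of 2-weights; a class of 2-weights in the
  plain sense is the self-indexed family with \<open>w\<close> the identity.
\<close>

record ('i, 'u) cone =
  Index :: 'i
  Diagram :: "'u stwo_ftr"
  Apex :: 'u
  Proj :: "'u \<Rightarrow> 'u sftr"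

definition is_two_cone :: "('i \<Rightarrow> 'u two_weight) \<Rightarrow> 'u stwo_cat \<Rightarrow> ('i, 'u) cone \<Rightarrow> bool" where
  "is_two_cone w S c \<longleftrightarrow>
     is_two_weight (w (Index c)) \<and>
     is_two_functor (Shape (w (Index c))) S (Diagram c) \<and>
     Apex c \<in> Obj S \<and>
     is_two_nat (Shape (w (Index c))) CAT (Weight (w (Index c)))
       (comp_two_ftr (Shape (w (Index c))) (two_hom S (Apex c)) (Diagram c)) (Proj c)"

definition is_F_cone :: "'u sF_cat \<Rightarrow> ('u F_weight, 'u) cone \<Rightarrow> bool" where
  "is_F_cone S c \<longleftrightarrow>
     is_F_weight (Index c) \<and>
     is_F_functor (FShape (Index c)) S (Diagram c) \<and>
     Apex c \<in> Obj (Loose S) \<and>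
     is_F_nat (FShape (Index c)) F_CAT (FWeight (Index c))
       (comp_two_ftr (Loose (FShape (Index c))) (F_hom S (Apex c)) (Diagram c)) (Proj c)"

text \<open>The image of a cone under a 2-functor; for F-cones it is used with \<open>w = loose_weight\<close>.\<close>

definition map_cone ::
  "('i \<Rightarrow> 'u two_weight) \<Rightarrow> 'u stwo_ftr \<Rightarrow> ('i, 'u) cone \<Rightarrow> ('i, 'u) cone" where
  "map_cone w F c =
    \<lparr>Index = Index c,
     Diagram = comp_two_ftr (Shape (w (Index c))) F (Diagram c),
     Apex = tob F (Apex c),
     Proj = (\<lambda>j\<in>Obj (Shape (w (Index c))).
        comp_ftr (tob (Weight (w (Index c))) j)
          (thom F (Apex c) (tob (Diagram c) j)) (Proj c j))\<rparr>"

text \<open>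
  The loose part of an F-cone. F-functors and F-natural transformations being represented by their
  loose parts, only the weight changes; \<open>r\<close> turns F-weights into indices of 2-weights.
\<close>

definition loose_cone :: "('u F_weight \<Rightarrow> 'i) \<Rightarrow> ('u F_weight, 'u) cone \<Rightarrow> ('i, 'u) cone" where
  "loose_cone r c = \<lparr>Index = r (Index c), Diagram = Diagram c, Apex = Apex c, Proj = Proj c\<rparr>"

section \<open>Sketches\<close>

record ('s, 'i, 'u) sketch =
  Base :: 's
  Cones :: "('i, 'u) cone set"

type_synonym ('i, 'u) two_sketch = "('u stwo_cat, 'i, 'u) sketch"
type_synonym 'u F_sketch = "('u sF_cat, 'u F_weight, 'u) sketch"

definition is_two_sketch :: "'i set \<Rightarrow> ('i \<Rightarrow> 'u two_weight) \<Rightarrow> ('i, 'u) two_sketch \<Rightarrow> bool" where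
  "is_two_sketch I w S \<longleftrightarrow> is_two_cat (Base S) \<and>
     (\<forall>c\<in>Cones S. is_two_cone w (Base S) c \<and> Index c \<in> I)"

definition is_F_sketch :: "'u F_weight set \<Rightarrow> 'u F_sketch \<Rightarrow> bool" where
  "is_F_sketch \<Psi> S \<longleftrightarrow> is_F_cat (Base S) \<and>
     (\<forall>c\<in>Cones S. is_F_cone (Base S) c \<and> Index c \<in> \<Psi>)"

definition is_two_sketch_mor ::
  "('i \<Rightarrow> 'u two_weight) \<Rightarrow> ('i, 'u) two_sketch \<Rightarrow> ('i, 'u) two_sketch \<Rightarrow> 'u stwo_ftr \<Rightarrow> bool" where
  "is_two_sketch_mor w S T F \<longleftrightarrow> is_two_functor (Base S) (Base T) F \<and>
     (\<forall>c\<in>Cones S. map_cone w F c \<in> Cones T)"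

definition is_F_sketch_mor :: "'u F_sketch \<Rightarrow> 'u F_sketch \<Rightarrow> 'u stwo_ftr \<Rightarrow> bool" where
  "is_F_sketch_mor S T F \<longleftrightarrow> is_F_functor (Base S) (Base T) F \<and>
     (\<forall>c\<in>Cones S. map_cone loose_weight F c \<in> Cones T)"

text \<open>
  Categories of sketches: an arrow is a morphism together with its source and target. Here \<open>B\<close> is
  the underlying 2-category of a sketch.
\<close>

definition sketch_cat ::
  "'k set \<Rightarrow> ('k \<Rightarrow> 'k \<Rightarrow> 'u stwo_ftr \<Rightarrow> bool) \<Rightarrow> ('k \<Rightarrow> 'u stwo_cat) \<Rightarrow>
   ('k, 'k \<times> 'u stwo_ftr \<times> 'k) cat" where
  "sketch_cat K mor B =
    (let M = {(S, F, T). S \<in> K \<and> T \<in> K \<and> mor S T F} in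
     \<lparr>Ob = K, Ar = M,
      Src = (\<lambda>(S, F, T)\<in>M. S),
      Tgt = (\<lambda>(S, F, T)\<in>M. T),
      Ident = (\<lambda>S\<in>K. (S, id_two_ftr (B S), S)),
      Cmp = (\<lambda>(S', G, T') (S, F, T).
        if (S', G, T') \<in> M \<and> (S, F, T) \<in> M \<and> T = S' then (S, comp_two_ftr (B S) G F, T')
        else undefined)\<rparr>)"

definition two_SK :: "'i set \<Rightarrow> ('i \<Rightarrow> 'u two_weight) \<Rightarrow>
  (('i, 'u) two_sketch, ('i, 'u) two_sketch \<times> 'u stwo_ftr \<times> ('i, 'u) two_sketch) cat" where
  "two_SK I w = sketch_cat {S. is_two_sketch I w S} (is_two_sketch_mor w) Base"

definition F_SK :: "'u F_weight set \<Rightarrow>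
  ('u F_sketch, 'u F_sketch \<times> 'u stwo_ftr \<times> 'u F_sketch) cat" where
  "F_SK \<Psi> = sketch_cat {S. is_F_sketch \<Psi> S} is_F_sketch_mor (\<lambda>S. Loose (Base S))"

definition loose_sketch :: "('u F_weight \<Rightarrow> 'i) \<Rightarrow> 'u F_sketch \<Rightarrow> ('i, 'u) two_sketch" where
  "loose_sketch r S = \<lparr>Base = Loose (Base S), Cones = loose_cone r ` Cones S\<rparr>"

definition loose_functor :: "'u F_weight set \<Rightarrow> ('u F_weight \<Rightarrow> 'i) \<Rightarrow>
  ('u F_sketch, 'u F_sketch \<times> 'u stwo_ftr \<times> 'u F_sketch,
   ('i, 'u) two_sketch, ('i, 'u) two_sketch \<times> 'u stwo_ftr \<times> ('i, 'u) two_sketch) ftr" where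
  "loose_functor \<Psi> r =
    \<lparr>fob = (\<lambda>S\<in>Ob (F_SK \<Psi>). loose_sketch r S),
     far = (\<lambda>(S, F, T)\<in>Ar (F_SK \<Psi>). (loose_sketch r S, F, loose_sketch r T))\<rparr>"

text \<open>
  The class \<open>{W_\<lambda> | W \<in> \<Psi>}\<close> of loose parts can be read in two ways, which agree when the
  F-weights in \<open>\<Psi>\<close> are determined by their loose parts: as the family of 2-weights indexed by
  \<open>\<Psi>\<close>, or as the plain image of \<open>\<Psi>\<close>. In the second reading a specified 2-cone does not
  remember from which of several F-weights with the same loose part its weight comes, and the
  forgetful functor has no left adjoint as soon as two F-weights in \<open>\<Psi>\<close> share a loose part.
\<close>

abbreviation (input) SK_indexed where
  "SK_indexed \<Psi> \<equiv> two_SK \<Psi> loose_weight"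

abbreviation (input) loose_functor_indexed where
  "loose_functor_indexed \<Psi> \<equiv> loose_functor \<Psi> (\<lambda>W. W)"

abbreviation (input) SK_plain where
  "SK_plain \<Psi> \<equiv> two_SK (loose_weight ` \<Psi>) (\<lambda>V. V)"

abbreviation (input) loose_functor_plain where
  "loose_functor_plain \<Psi> \<equiv> loose_functor \<Psi> loose_weight"

section \<open>Coreflective left adjoints\<close>

definition is_left_adjoint ::
  "('o, 'a) cat \<Rightarrow> ('p, 'b) cat \<Rightarrow> ('p, 'b, 'o, 'a) ftr \<Rightarrow> ('o, 'a, 'p, 'b) ftr \<Rightarrow> bool" where
  "is_left_adjoint C D L U \<longleftrightarrow>
     is_functor D C L \<and> is_functor C D U \<and>
     (\<exists>\<phi>. \<forall>d\<in>Ob D. \<forall>c\<in>Ob C.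
        bij_betw (\<phi> d c) (hom C (fob L d) c) (hom D d (fob U c)) \<and>
        (\<forall>f\<in>hom C (fob L d) c.
           (\<forall>c'\<in>Ob C. \<forall>h\<in>hom C c c'. \<phi> d c' (Cmp C h f) = Cmp D (far U h) (\<phi> d c f)) \<and>
           (\<forall>d'\<in>Ob D. \<forall>g\<in>hom D d' d. \<phi> d' c (Cmp C f (far L g)) = Cmp D (\<phi> d c f) g)))"

definition has_coreflective_left_adjoint ::
  "('o, 'a) cat \<Rightarrow> ('p, 'b) cat \<Rightarrow> ('o, 'a, 'p, 'b) ftr \<Rightarrow> bool" where
  "has_coreflective_left_adjoint C D U \<longleftrightarrow>
     (\<exists>L. is_left_adjoint C D L U \<and> fully_faithful D C L)"

end

theory Submission
  imports Defs
begin

text \<open>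
  The left adjoint keeps the underlying 2-category and the specified cones of a 2-sketch and
  declares tight the least class of 1-cells that contains the units, is closed under composition
  and makes every specified cone an F-cone. Since the tight part of a hom of an F-category is a
  full subcategory, being an F-cone only asks that certain 1-cells be tight, namely the images of
  the tight 1-cells of the shape under the diagram and the projections at the tight objects of the
  weight. Hence a 2-sketch morphism into the loose part of an F-sketch preserves tightness
  automatically. Forgetting the tight cells again gives back the 2-sketch on the nose, so the unit
  is the identity and the left adjoint is fully faithful.
\<close>

section \<open>Functors and 2-functors\<close>

lemma hom_iff: "f \<in> hom C x y \<longleftrightarrow> f \<in> Ar C \<and> Src C f = x \<and> Tgt C f = y"
  by (simp add: hom_def)

lemma is_functor_id: "is_category A \<Longrightarrow> is_functor A A (id_ftr A)"
  unfolding is_functor_def id_ftr_def is_category_def hom_def by (auto simp: PiE_iff)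

lemma is_functor_comp:
  assumes "is_functor A B F" "is_functor B C G"
  shows "is_functor A C (comp_ftr A G F)"
proof -
  have A: "is_category A" and B: "is_category B"
    and *: "\<And>x. x \<in> Ob A \<Longrightarrow> fob F x \<in> Ob B" "\<And>f. f \<in> Ar A \<Longrightarrow> far F f \<in> Ar B"
    "\<And>x. x \<in> Ob B \<Longrightarrow> fob G x \<in> Ob C" "\<And>f. f \<in> Ar B \<Longrightarrow> far G f \<in> Ar C"
    using assms unfolding is_functor_def by (auto simp: PiE_iff)
  have **: "\<And>f. f \<in> Ar A \<Longrightarrow> Src A f \<in> Ob A" "\<And>f. f \<in> Ar A \<Longrightarrow> Tgt A f \<in> Ob A"
    "\<And>x. x \<in> Ob A \<Longrightarrow> Ident A x \<in> Ar A"
    "\<And>f g. f \<in> Ar A \<Longrightarrow> g \<in> Ar A \<Longrightarrow> Tgt A f = Src A g \<Longrightarrow> Cmp A g f \<in> Ar A"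
    using A unfolding is_category_def hom_def by (auto simp: PiE_iff)
  show ?thesis
    using assms unfolding is_functor_def comp_ftr_def by (auto simp: * **)
qed

lemma functor_ob: "is_functor A B F \<Longrightarrow> x \<in> Ob A \<Longrightarrow> fob F x \<in> Ob B"
  by (auto simp: is_functor_def)

lemma functor_ar: "is_functor A B F \<Longrightarrow> f \<in> Ar A \<Longrightarrow> far F f \<in> Ar B"
  by (auto simp: is_functor_def)

lemma functor_extensional:
  assumes "is_functor A B F"
  shows "fob F \<in> extensional (Ob A)" "far F \<in> extensional (Ar A)"
  using assms by (auto simp: is_functor_def PiE_def)

text \<open>On the left the inner composite is restricted to \<open>B\<close>; since
  \<open>F\<close> lands in \<open>B\<close>, that restriction has no effect and both sides are the
  same functions on \<open>A\<close>.\<close>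

lemma comp_ftr_assoc:
  assumes "is_functor A B F"
  shows "comp_ftr A (comp_ftr B H G) F = comp_ftr A H (comp_ftr A G F)"
  using assms by (auto simp: comp_ftr_def functor_ob functor_ar intro!: restrict_ext)

text \<open>An equality of records: it holds because \<open>is_functor\<close> makes
  \<open>fob\<close> and \<open>far\<close> undefined off their domains, exactly as the restrictions
  in \<open>comp_ftr\<close> do.\<close>

lemma comp_ftr_id_right: "is_functor A B F \<Longrightarrow> comp_ftr A F (id_ftr A) = F"
  using functor_extensional[of A B F]
  by (cases F) (auto simp: comp_ftr_def id_ftr_def intro!: extensionalityI[OF restrict_extensional])

lemma comp_ftr_id_left: "is_functor A B F \<Longrightarrow> comp_ftr A (id_ftr B) F = F"
  using functor_extensional[of A B F]
  by (cases F) (auto simp: comp_ftr_def id_ftr_def functor_ob[of A B F] functor_ar[of A B F]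
    dest: functor_ob functor_ar intro!: extensionalityI[OF restrict_extensional])

section \<open>2-functors: typing, identities and composition\<close>

lemma two_functor_ob: "is_two_functor A B F \<Longrightarrow> X \<in> Obj A \<Longrightarrow> tob F X \<in> Obj B"
  by (auto simp: is_two_functor_def)

lemma two_functor_functor:
  "is_two_functor A B F \<Longrightarrow> X \<in> Obj A \<Longrightarrow> Y \<in> Obj A \<Longrightarrow>
    is_functor (Hom A X Y) (Hom B (tob F X) (tob F Y)) (thom F X Y)"
  by (auto simp: is_two_functor_def)

lemma two_functor_extensional: "is_two_functor A B F \<Longrightarrow> tob F \<in> extensional (Obj A)"
  by (auto simp: is_two_functor_def PiE_def)

lemma two_functor_undefined:
  "is_two_functor A B F \<Longrightarrow> \<not> (X \<in> Obj A \<and> Y \<in> Obj A) \<Longrightarrow> thom F X Y = undefined"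
  unfolding is_two_functor_def by metis

lemma two_functor_comp1:
  "is_two_functor A B F \<Longrightarrow> X \<in> Obj A \<Longrightarrow> Y \<in> Obj A \<Longrightarrow> Z \<in> Obj A \<Longrightarrow>
    f \<in> Ob (Hom A X Y) \<Longrightarrow> g \<in> Ob (Hom A Y Z) \<Longrightarrow>
    fob (thom F X Z) (comp1 A X Y Z g f) =
      comp1 B (tob F X) (tob F Y) (tob F Z) (fob (thom F Y Z) g) (fob (thom F X Y) f)"
  unfolding is_two_functor_def by blast

lemma two_functor_comp2:
  "is_two_functor A B F \<Longrightarrow> X \<in> Obj A \<Longrightarrow> Y \<in> Obj A \<Longrightarrow> Z \<in> Obj A \<Longrightarrow>
    a \<in> Ar (Hom A X Y) \<Longrightarrow> b \<in> Ar (Hom A Y Z) \<Longrightarrow>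
    far (thom F X Z) (comp2 A X Y Z b a) =
      comp2 B (tob F X) (tob F Y) (tob F Z) (far (thom F Y Z) b) (far (thom F X Y) a)"
  unfolding is_two_functor_def by blast

lemma two_functor_unit:
  "is_two_functor A B F \<Longrightarrow> X \<in> Obj A \<Longrightarrow> fob (thom F X X) (Unit A X) = Unit B (tob F X)"
  unfolding is_two_functor_def by blast

lemma two_cat_category: "is_two_cat C \<Longrightarrow> X \<in> Obj C \<Longrightarrow> Y \<in> Obj C \<Longrightarrow> is_category (Hom C X Y)"
  by (simp add: is_two_cat_def)

lemma two_cat_unit: "is_two_cat C \<Longrightarrow> X \<in> Obj C \<Longrightarrow> Unit C X \<in> Ob (Hom C X X)"
  by (simp add: is_two_cat_def)

lemma two_cat_comp:
  assumes "is_two_cat C" "X \<in> Obj C" "Y \<in> Obj C" "Z \<in> Obj C"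
  shows "f \<in> Ob (Hom C X Y) \<Longrightarrow> g \<in> Ob (Hom C Y Z) \<Longrightarrow> comp1 C X Y Z g f \<in> Ob (Hom C X Z)"
    and "a \<in> Ar (Hom C X Y) \<Longrightarrow> b \<in> Ar (Hom C Y Z) \<Longrightarrow> comp2 C X Y Z b a \<in> Ar (Hom C X Z)"
proof -
  have *: "is_functor (prod_cat (Hom C Y Z) (Hom C X Y)) (Hom C X Z) (HComp C X Y Z)"
    using assms unfolding is_two_cat_def by blast
  show "f \<in> Ob (Hom C X Y) \<Longrightarrow> g \<in> Ob (Hom C Y Z) \<Longrightarrow> comp1 C X Y Z g f \<in> Ob (Hom C X Z)"
    using functor_ob[OF *, of "(g, f)"] by (simp add: prod_cat_def)
  show "a \<in> Ar (Hom C X Y) \<Longrightarrow> b \<in> Ar (Hom C Y Z) \<Longrightarrow> comp2 C X Y Z b a \<in> Ar (Hom C X Z)"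
    using functor_ar[OF *, of "(b, a)"] by (simp add: prod_cat_def)
qed

lemma is_two_functor_id:
  assumes "is_two_cat A"
  shows "is_two_functor A A (id_two_ftr A)"
  unfolding is_two_functor_def id_two_ftr_def
  using assms two_cat_category[OF assms] two_cat_unit[OF assms] two_cat_comp[OF assms]
  \<comment> \<open>\<open>id_ftr\<close> has to stay folded for \<open>is_functor_id\<close> to
    apply to the homs; it is unfolded only afterwards, for the equations on cells.\<close>
  by (simp add: is_functor_id) (simp add: id_ftr_def)

lemma is_two_functor_comp:
  assumes A: "is_two_cat A" and F: "is_two_functor A B F" and G: "is_two_functor B C G"
  shows "is_two_functor A C (comp_two_ftr A G F)"
proof -
  note [simp] = two_functor_ob[OF F] two_functor_ob[OF G]
    functor_ob[OF two_functor_functor[OF F]] functor_ar[OF two_functor_functor[OF F]]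
    two_cat_unit[OF A] two_cat_comp[OF A] two_functor_unit[OF F] two_functor_unit[OF G]
    two_functor_comp1[OF F] two_functor_comp1[OF G] two_functor_comp2[OF F] two_functor_comp2[OF G]
  have "is_functor (Hom A X Y) (Hom C (tob G (tob F X)) (tob G (tob F Y)))
      (comp_ftr (Hom A X Y) (thom G (tob F X) (tob F Y)) (thom F X Y))"
    if "X \<in> Obj A" "Y \<in> Obj A" for X Y
    using that by (intro is_functor_comp[OF two_functor_functor[OF F] two_functor_functor[OF G]]) auto
  then show ?thesis
    unfolding is_two_functor_def comp_two_ftr_def by simp (simp add: comp_ftr_def)
qed

lemma comp_two_ftr_assoc:
  assumes "is_two_functor A B F"
  shows "comp_two_ftr A (comp_two_ftr B H G) F = comp_two_ftr A H (comp_two_ftr A G F)"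
  using assms
  by (auto simp: comp_two_ftr_def two_functor_ob fun_eq_iff comp_ftr_assoc[OF two_functor_functor])

lemma comp_two_ftr_id_right:
  assumes "is_two_functor A B F"
  shows "comp_two_ftr A F (id_two_ftr A) = F"
proof -
  have "(\<lambda>X\<in>Obj A. tob F (tob (id_two_ftr A) X)) = tob F"
    using two_functor_extensional[OF assms]
    by (intro extensionalityI[OF restrict_extensional]) (auto simp: id_two_ftr_def)
  moreover have "(\<lambda>X Y. if X \<in> Obj A \<and> Y \<in> Obj A
        then comp_ftr (Hom A X Y) (thom F (tob (id_two_ftr A) X) (tob (id_two_ftr A) Y))
          (thom (id_two_ftr A) X Y) else undefined) = thom F"
    using two_functor_undefined[OF assms] comp_ftr_id_right[OF two_functor_functor[OF assms]]
    by (auto simp: id_two_ftr_def fun_eq_iff)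
  ultimately show ?thesis
    by (simp add: comp_two_ftr_def)
qed

lemma comp_two_ftr_id_left:
  assumes "is_two_functor A B F"
  shows "comp_two_ftr A (id_two_ftr B) F = F"
proof -
  have "(\<lambda>X\<in>Obj A. tob (id_two_ftr B) (tob F X)) = tob F"
    using two_functor_extensional[OF assms] two_functor_ob[OF assms]
    by (intro extensionalityI[OF restrict_extensional]) (auto simp: id_two_ftr_def)
  moreover have "(\<lambda>X Y. if X \<in> Obj A \<and> Y \<in> Obj A
        then comp_ftr (Hom A X Y) (thom (id_two_ftr B) (tob F X) (tob F Y)) (thom F X Y)
        else undefined) = thom F"
    using two_functor_undefined[OF assms] comp_ftr_id_left[OF two_functor_functor[OF assms]]
      two_functor_ob[OF assms]
    by (auto simp: id_two_ftr_def fun_eq_iff)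
  ultimately show ?thesis
    by (simp add: comp_two_ftr_def)
qed

section \<open>Full subcategories and tight functors\<close>

lemma is_category_full_subcat:
  assumes "is_category C" "T \<subseteq> Ob C"
  shows "is_category (full_subcat C T)"
proof -
  have *: "Src C \<in> Ar C \<rightarrow>\<^sub>E Ob C" "Tgt C \<in> Ar C \<rightarrow>\<^sub>E Ob C"
    "\<And>x. x \<in> Ob C \<Longrightarrow> Ident C x \<in> Ar C \<and> Src C (Ident C x) = x \<and> Tgt C (Ident C x) = x"
    "\<And>f g. f \<in> Ar C \<Longrightarrow> g \<in> Ar C \<Longrightarrow> Tgt C f = Src C g \<Longrightarrow>
       Cmp C g f \<in> Ar C \<and> Src C (Cmp C g f) = Src C f \<and> Tgt C (Cmp C g f) = Tgt C g"
    "\<And>f g. \<not> (f \<in> Ar C \<and> g \<in> Ar C \<and> Tgt C f = Src C g) \<Longrightarrow> Cmp C g f = undefined"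
    "\<And>f. f \<in> Ar C \<Longrightarrow> Cmp C f (Ident C (Src C f)) = f \<and> Cmp C (Ident C (Tgt C f)) f = f"
    "\<And>f g h. f \<in> Ar C \<Longrightarrow> g \<in> Ar C \<Longrightarrow> h \<in> Ar C \<Longrightarrow> Tgt C f = Src C g \<Longrightarrow> Tgt C g = Src C h \<Longrightarrow>
        Cmp C h (Cmp C g f) = Cmp C (Cmp C h g) f"
    using assms(1) unfolding is_category_def hom_iff by blast+
  show ?thesis
    unfolding is_category_def hom_iff full_subcat_def Let_def using assms(2) *
    by (auto simp: subset_eq)
qed

text \<open>By fullness, an arrow between objects of \<open>T\<close> is automatically in the
  subcategory, so factoring through it is a condition on objects alone. This is the source of every
  reduction of tightness to 1-cells below.\<close>

lemma is_functor_full_subcat_iff: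
  assumes "is_category C" "T \<subseteq> Ob C"
  shows "is_functor A (full_subcat C T) G \<longleftrightarrow> is_functor A C G \<and> fob G ` Ob A \<subseteq> T"
proof (cases "is_category A")
  case True
  then have A: "\<And>f. f \<in> Ar A \<Longrightarrow> Src A f \<in> Ob A \<and> Tgt A f \<in> Ob A"
    by (auto simp: is_category_def)
  show ?thesis
    using assms(2) A True assms(1) is_category_full_subcat[OF assms]
    unfolding is_functor_def full_subcat_def Let_def
    by (auto simp: PiE_iff subset_eq image_subset_iff)
\<comment> \<open>If \<open>A\<close> is not a category, both sides are false.\<close>
qed (simp add: is_functor_def)

section \<open>Hom objects of an F-category and tight functors into them\<close>

lemma F_cat_two_cat: "is_F_cat S \<Longrightarrow> is_two_cat (Loose S)"
  by (simp add: is_F_cat_def)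

lemma F_cat_Tight:
  "is_F_cat S \<Longrightarrow> X \<in> Obj (Loose S) \<Longrightarrow> Y \<in> Obj (Loose S) \<Longrightarrow> Tight S X Y \<subseteq> Ob (Hom (Loose S) X Y)"
  by (simp add: is_F_cat_def)

lemma F_cat_Tight_unit: "is_F_cat S \<Longrightarrow> X \<in> Obj (Loose S) \<Longrightarrow> Unit (Loose S) X \<in> Tight S X X"
  by (simp add: is_F_cat_def)

lemma F_cat_Tight_comp:
  "is_F_cat S \<Longrightarrow> X \<in> Obj (Loose S) \<Longrightarrow> Y \<in> Obj (Loose S) \<Longrightarrow> Z \<in> Obj (Loose S) \<Longrightarrow>
    f \<in> Tight S X Y \<Longrightarrow> g \<in> Tight S Y Z \<Longrightarrow> comp1 (Loose S) X Y Z g f \<in> Tight S X Z"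
  by (simp add: is_F_cat_def)

text \<open>The inclusion of a full subcategory is a full embedding. The fact is needed because
  \<open>Tight F_CAT\<close> has its intended value only between objects of F.\<close>

lemma is_F_obj_F_hom_obj:
  assumes S: "is_F_cat S" "X \<in> Obj (Loose S)" "Y \<in> Obj (Loose S)"
  shows "is_F_obj (F_hom_obj S X Y)"
proof -
  let ?C = "Hom (Loose S) X Y" and ?T = "Tight S X Y"
  have C: "is_category ?C" and T: "?T \<subseteq> Ob ?C"
    using two_cat_category[OF F_cat_two_cat[OF S(1)] S(2,3)] F_cat_Tight[OF S] .
  \<comment> \<open>The inclusion is the identity functor of the subcategory, read as a functor into
    the whole hom.\<close>
  have "is_functor (full_subcat ?C ?T) ?C (id_ftr (full_subcat ?C ?T))"
    using is_functor_id[OF is_category_full_subcat[OF C T]] is_functor_full_subcat_iff[OF C T] by blast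
  moreover have "fully_faithful (full_subcat ?C ?T) ?C (id_ftr (full_subcat ?C ?T))"
  proof -
    have "hom (full_subcat ?C ?T) x y = hom ?C x y" if "x \<in> ?T" "y \<in> ?T" for x y
      using that by (auto simp: full_subcat_def hom_def Let_def)
    moreover have "bij_betw (far (id_ftr (full_subcat ?C ?T))) M M"
      if "M \<subseteq> Ar (full_subcat ?C ?T)" for M
      using that by (subst bij_betw_cong[where g = id]) (auto simp: id_ftr_def)
    moreover have "hom ?C x y \<subseteq> Ar (full_subcat ?C ?T)" if "x \<in> ?T" "y \<in> ?T" for x y
      using that by (auto simp: full_subcat_def hom_def Let_def)
    moreover have "Ob (full_subcat ?C ?T) = ?T"
      by (simp add: full_subcat_def Let_def)
    ultimately show ?thesis
      by (simp add: fully_faithful_def id_ftr_def)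
  qed
  ultimately show ?thesis
    by (auto simp: is_F_obj_def F_hom_obj_def Let_def id_ftr_def inj_on_def)
qed

lemma Lam_F_hom_obj [simp]: "Lam (F_hom_obj S X Y) = Hom (Loose S) X Y"
  by (simp add: F_hom_obj_def Let_def)

text \<open>The embedding of \<open>F_hom_obj S X Y\<close> is an inclusion, so the functor on tight
  parts is forced to be \<open>F\<close> after \<open>Emb A\<close>. It exists exactly when this
  composite lands in the full subcategory of tight 1-cells, which can be tested on objects.\<close>

lemma Tight_F_CAT_iff:
  assumes S: "is_F_cat S" "X \<in> Obj (Loose S)" "Y \<in> Obj (Loose S)" and A: "is_F_obj A"
  shows "F \<in> Tight F_CAT A (F_hom_obj S X Y) \<longleftrightarrow>
    is_functor (Lam A) (Hom (Loose S) X Y) F \<and>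
    (\<forall>x\<in>Ob (Tau A). fob F (fob (Emb A) x) \<in> Tight S X Y)"
proof -
  let ?C = "Hom (Loose S) X Y" and ?T = "Tight S X Y"
  let ?D = "full_subcat ?C ?T"
  have C: "is_category ?C" and T: "?T \<subseteq> Ob ?C"
    using two_cat_category[OF F_cat_two_cat[OF S(1)] S(2,3)] F_cat_Tight[OF S] .
  have ObD: "Ob ?D = ?T"
    by (simp add: full_subcat_def Let_def)
  have E: "is_functor (Tau A) (Lam A) (Emb A)"
    using A by (simp add: is_F_obj_def)
  have "(\<exists>G. is_functor (Tau A) ?D G \<and>
      comp_ftr (Tau A) F (Emb A) = comp_ftr (Tau A) (id_ftr ?D) G) \<longleftrightarrow>
      (\<forall>x\<in>Ob (Tau A). fob F (fob (Emb A) x) \<in> ?T)" (is "?l \<longleftrightarrow> ?r")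
    if F: "is_functor (Lam A) ?C F"
  proof
    assume ?l
    then obtain G where G: "is_functor (Tau A) ?D G" "comp_ftr (Tau A) F (Emb A) = G"
      using comp_ftr_id_left by metis
    show ?r
    proof
      fix x assume "x \<in> Ob (Tau A)"
      then show "fob F (fob (Emb A) x) \<in> ?T"
        using functor_ob[OF G(1)] G(2) ObD by (auto simp: comp_ftr_def)
    qed
  next
    assume ?r
    \<comment> \<open>The witness for \<open>G\<close> is the composite itself, now with the full
      subcategory as codomain.\<close>
    then have "is_functor (Tau A) ?D (comp_ftr (Tau A) F (Emb A))"
      unfolding is_functor_full_subcat_iff[OF C T] using is_functor_comp[OF E F]
      by (auto simp: comp_ftr_def)
    then show ?l
      using comp_ftr_id_left by metis
  qed
  then show ?thesis
    using A is_F_obj_F_hom_obj[OF S] by (auto simp: F_CAT_def F_hom_obj_def Let_def)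
qed

section \<open>F-cones and their loose parts\<close>

text \<open>The homs and compositions of \<open>cat_over U L\<close> are by definition those of CAT
  between the values of \<open>L\<close>. Hence applying \<open>L\<close> to the object part changes
  none of the conditions on cells.\<close>

lemma is_two_functor_cat_over_iff:
  assumes "\<And>x. x \<in> U \<Longrightarrow> is_category (L x)" "\<And>X. X \<in> Obj A \<Longrightarrow> tob F X \<in> U"
    "tob F \<in> extensional (Obj A)"
  shows "is_two_functor A (cat_over U L) F \<longleftrightarrow>
    is_two_functor A CAT \<lparr>tob = (\<lambda>X\<in>Obj A. L (tob F X)), thom = thom F\<rparr>"
  using assms unfolding is_two_functor_def CAT_def cat_over_def by (simp add: PiE_iff)

lemma is_two_nat_cat_over_iff:
  assumes "\<And>x. x \<in> U \<Longrightarrow> is_category (L x)"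
    "\<And>X. X \<in> Obj A \<Longrightarrow> tob F X \<in> U" "tob F \<in> extensional (Obj A)"
    "\<And>X. X \<in> Obj A \<Longrightarrow> tob G X \<in> U" "tob G \<in> extensional (Obj A)"
  shows "is_two_nat A (cat_over U L) F G t \<longleftrightarrow>
    is_two_nat A CAT \<lparr>tob = (\<lambda>X\<in>Obj A. L (tob F X)), thom = thom F\<rparr>
      \<lparr>tob = (\<lambda>X\<in>Obj A. L (tob G X)), thom = thom G\<rparr> t"
proof -
  have F: "is_two_functor A (cat_over U L) F \<longleftrightarrow>
      is_two_functor A CAT \<lparr>tob = (\<lambda>X\<in>Obj A. L (tob F X)), thom = thom F\<rparr>"
    and G: "is_two_functor A (cat_over U L) G \<longleftrightarrow>
      is_two_functor A CAT \<lparr>tob = (\<lambda>X\<in>Obj A. L (tob G X)), thom = thom G\<rparr>"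
    by (rule is_two_functor_cat_over_iff; use assms in simp)+
  show ?thesis
    unfolding is_two_nat_def F G
    using assms(1,2,4) by (simp add: CAT_def cat_over_def)
qed

lemma F_obj_category: "is_F_obj A \<Longrightarrow> is_category (Lam A)"
  by (simp add: is_F_obj_def is_functor_def)

lemma Loose_F_CAT: "Loose F_CAT = cat_over {A. is_F_obj A} Lam"
  by (simp add: F_CAT_def)

lemma F_weight_two_weight:
  assumes "is_F_weight W"
  shows "is_two_weight (loose_weight W)"
proof -
  have F: "is_two_functor (Loose (FShape W)) (cat_over {A. is_F_obj A} Lam) (FWeight W)"
    using assms by (simp add: is_F_weight_def is_F_functor_def Loose_F_CAT)
  have "is_two_functor (Loose (FShape W)) CAT
      \<lparr>tob = (\<lambda>X\<in>Obj (Loose (FShape W)). Lam (tob (FWeight W) X)), thom = thom (FWeight W)\<rparr>"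
    using F two_functor_ob[OF F] two_functor_extensional[OF F]
    by (subst is_two_functor_cat_over_iff[symmetric, where U = "{A. is_F_obj A}"])
      (auto simp: F_obj_category cat_over_def)
  then show ?thesis
    using assms by (simp add: is_F_weight_def is_F_cat_def is_two_weight_def loose_weight_def)
qed

text \<open>Three tightness conditions separate an F-cone from its loose part: on the diagram, on
  S(X,D-), and on the components of the transformation. The second follows from the first because
  tight 1-cells of \<open>S\<close> compose, and the third is made explicit by
  \<open>Tight_F_CAT_iff\<close>.\<close>

lemma is_F_cone_iff:
  assumes S: "is_F_cat S" and W: "is_F_weight (Index c)"
  defines "J \<equiv> Obj (Loose (FShape (Index c)))"
  shows "is_F_cone S c \<longleftrightarrow> is_two_cone loose_weight (Loose S) c \<and>
    (\<forall>i\<in>J. \<forall>j\<in>J. \<forall>f\<in>Tight (FShape (Index c)) i j.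
      fob (thom (Diagram c) i j) f \<in> Tight S (tob (Diagram c) i) (tob (Diagram c) j)) \<and>
    (\<forall>j\<in>J. \<forall>x\<in>Ob (Tau (tob (FWeight (Index c)) j)).
      fob (Proj c j) (fob (Emb (tob (FWeight (Index c)) j)) x) \<in> Tight S (Apex c) (tob (Diagram c) j))"
    (is "_ \<longleftrightarrow> ?two \<and> ?diag \<and> ?proj")
\<comment> \<open>Both sides of the equivalence contain these two conditions, so both fail outside
  this case. Inside it, all hom objects S(X,Dj) are objects of F.\<close>
proof (cases "is_two_functor (Loose (FShape (Index c))) (Loose S) (Diagram c) \<and> Apex c \<in> Obj (Loose S)")
  case True
  let ?A = "Loose (FShape (Index c))" and ?W = "FWeight (Index c)" and ?D = "Diagram c" and ?X = "Apex c"
  let ?G = "comp_two_ftr ?A (F_hom S ?X) ?D"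
  have D: "is_two_functor ?A (Loose S) ?D" and X: "?X \<in> Obj (Loose S)"
    using True by auto
  note DJ = two_functor_ob[OF D]
  have sh: "is_F_cat (FShape (Index c))" and wF: "is_F_functor (FShape (Index c)) F_CAT ?W"
    using W by (auto simp: is_F_weight_def)
  have w: "is_two_functor ?A (cat_over {A. is_F_obj A} Lam) ?W"
    using wF by (simp add: is_F_functor_def Loose_F_CAT)
  have wJ: "is_F_obj (tob ?W j)" if "j \<in> J" for j
    using two_functor_ob[OF w] that by (simp add: cat_over_def J_def)
  have tobG: "tob ?G j = F_hom_obj S ?X (tob ?D j)" if "j \<in> J" for j
    using that DJ by (simp add: comp_two_ftr_def F_hom_def J_def)
  have GJ: "is_F_obj (tob ?G j)" if "j \<in> J" for j
    using that tobG is_F_obj_F_hom_obj[OF S X] DJ by (simp add: J_def)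
  \<comment> \<open>Forgetting the tight parts of S(X,D-) gives the 2-functor that occurs in the
    loose cone.\<close>
  have loose_G: "\<lparr>tob = (\<lambda>j\<in>Obj ?A. Lam (tob ?G j)), thom = thom ?G\<rparr> =
      comp_two_ftr ?A (two_hom (Loose S) ?X) ?D"
    using DJ by (auto simp: comp_two_ftr_def F_hom_def two_hom_def fun_eq_iff)
  have Gext: "tob ?G \<in> extensional (Obj ?A)"
    by (simp add: comp_two_ftr_def)
  note wext = two_functor_extensional[OF w]
  have nat_iff: "is_two_nat ?A (Loose F_CAT) ?W ?G (Proj c) \<longleftrightarrow> ?two"
    unfolding Loose_F_CAT
    by (subst is_two_nat_cat_over_iff)
      (use wJ GJ wext Gext F_weight_two_weight[OF W] D X loose_G in
        \<open>auto simp: is_two_cone_def loose_weight_def J_def F_obj_category\<close>)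
  have proj_iff: "(\<forall>j\<in>J. Proj c j \<in> Tight F_CAT (tob ?W j) (tob ?G j)) \<longleftrightarrow> ?proj" if ?two
  proof -
    have "is_functor (Lam (tob ?W j)) (Hom (Loose S) ?X (tob ?D j)) (Proj c j)" if "j \<in> J" for j
    proof -
      have "Proj c j \<in> Ob (Hom (Loose F_CAT) (tob ?W j) (tob ?G j))"
        using \<open>?two\<close> that unfolding nat_iff[symmetric] is_two_nat_def J_def by blast
      then show ?thesis
        using that wJ GJ tobG by (simp add: Loose_F_CAT cat_over_def functor_cat_def)
    qed
    then show ?thesis
      using Tight_F_CAT_iff[OF S X DJ wJ] tobG by (simp add: J_def)
  qed
  \<comment> \<open>The 2-functor S(X,D-) sends a tight \<open>f\<close> to postcomposition with
    \<open>?g\<close>, the image of \<open>f\<close> under the diagram. As \<open>?g\<close> is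
    tight, postcomposition with it preserves tight 1-cells out of the apex.\<close>
  have G_functor: "is_F_functor (FShape (Index c)) F_CAT ?G" if ?two ?diag
  proof -
    have G2: "is_two_functor ?A (Loose F_CAT) ?G"
      using \<open>?two\<close> unfolding nat_iff[symmetric] is_two_nat_def by blast
    moreover have "fob (thom ?G i j) f \<in> Tight F_CAT (tob ?G i) (tob ?G j)"
      if i: "i \<in> J" and j: "j \<in> J" and f: "f \<in> Tight (FShape (Index c)) i j" for i j f
    proof -
      let ?i = "tob ?D i" and ?j = "tob ?D j"
      have fl: "f \<in> Ob (Hom ?A i j)"
        using F_cat_Tight[OF sh] i j f by (auto simp: J_def)
      let ?g = "fob (thom ?D i j) f"
      have gt: "?g \<in> Tight S ?i ?j"
        using \<open>?diag\<close> i j f by blast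
      have gl: "?g \<in> Ob (Hom (Loose S) ?i ?j)"
        using functor_ob[OF two_functor_functor[OF D] fl] i j by (simp add: J_def)
      have eq: "fob (thom ?G i j) f = postcomp1 (Loose S) ?X ?i ?j ?g"
        using i j fl gl DJ
        by (simp add: comp_two_ftr_def F_hom_def two_hom_def comp_ftr_def postcomp_def J_def)
      have "fob (thom ?G i j) f \<in> Ob (Hom (Loose F_CAT) (tob ?G i) (tob ?G j))"
        using functor_ob[OF two_functor_functor[OF G2] fl] i j by (simp add: J_def)
      then have "is_functor (Lam (tob ?G i)) (Hom (Loose S) ?X ?j) (fob (thom ?G i j) f)"
        using i j GJ tobG by (simp add: Loose_F_CAT cat_over_def functor_cat_def)
      moreover have "fob (fob (thom ?G i j) f) (fob (Emb (tob ?G i)) x) \<in> Tight S ?X ?j"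
        if "x \<in> Ob (Tau (tob ?G i))" for x
      proof -
        have x: "x \<in> Tight S ?X ?i"
          using that i tobG by (simp add: F_hom_obj_def full_subcat_def Let_def)
        then have "fob (Emb (tob ?G i)) x = x"
          using i tobG by (simp add: F_hom_obj_def full_subcat_def Let_def id_ftr_def)
        moreover have "x \<in> Ob (Hom (Loose S) ?X ?i)"
          using F_cat_Tight[OF S X DJ] i x by (auto simp: J_def)
        moreover have "comp1 (Loose S) ?X ?i ?j ?g x \<in> Tight S ?X ?j"
          using F_cat_Tight_comp[OF S X DJ DJ x gt] i j by (simp add: J_def)
        ultimately show ?thesis
          unfolding eq by (simp add: postcomp1_def)
      qed
      ultimately show ?thesis
        using Tight_F_CAT_iff[OF S X DJ GJ] i j tobG by (simp add: J_def)
    qed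
    ultimately show ?thesis
      unfolding is_F_functor_def J_def by blast
  qed
  have "is_F_functor (FShape (Index c)) S ?D \<longleftrightarrow> ?diag"
    using D by (simp add: is_F_functor_def J_def)
  then have "is_F_cone S c \<longleftrightarrow> ?diag \<and> is_F_functor (FShape (Index c)) F_CAT ?G \<and> ?two \<and>
      (\<forall>j\<in>J. Proj c j \<in> Tight F_CAT (tob ?W j) (tob ?G j))"
    using W X wF nat_iff unfolding is_F_cone_def is_F_nat_def J_def by blast
  then show ?thesis
    using proj_iff G_functor by blast
next
  case False
  then show ?thesis
    by (auto simp: is_F_cone_def is_two_cone_def is_F_functor_def loose_weight_def)
qed

lemma F_cone_two_cone:
  assumes "is_F_cat S" "is_F_cone S c"
  shows "is_two_cone loose_weight (Loose S) c"
proof -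
  have "is_F_weight (Index c)"
    using assms(2) by (simp add: is_F_cone_def)
  from is_F_cone_iff[OF assms(1) this] show ?thesis
    using assms(2) by blast
qed

section \<open>Images of cones under 2-functors\<close>

lemma two_cone_proj:
  assumes "is_two_cone w S c" and j: "j \<in> Obj (Shape (w (Index c)))"
  shows "is_functor (tob (Weight (w (Index c))) j) (Hom S (Apex c) (tob (Diagram c) j)) (Proj c j)"
proof -
  let ?A = "Shape (w (Index c))" and ?W = "Weight (w (Index c))"
  let ?H = "comp_two_ftr ?A (two_hom S (Apex c)) (Diagram c)"
  have D: "is_two_functor ?A S (Diagram c)" and nat: "is_two_nat ?A CAT ?W ?H (Proj c)"
    using assms by (auto simp: is_two_cone_def)
  have W: "is_two_functor ?A CAT ?W" and H: "is_two_functor ?A CAT ?H"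
    using nat by (auto simp: is_two_nat_def)
  have "Proj c j \<in> Ob (Hom CAT (tob ?W j) (tob ?H j))"
    using nat j by (simp add: is_two_nat_def)
  moreover have "tob ?H j = Hom S (Apex c) (tob (Diagram c) j)"
    using j two_functor_ob[OF D] by (simp add: comp_two_ftr_def two_hom_def)
  moreover have "is_category (tob ?W j)" "is_category (tob ?H j)"
    using two_functor_ob[OF W j] two_functor_ob[OF H j] by (simp_all add: CAT_def cat_over_def)
  ultimately show ?thesis
    by (simp add: CAT_def cat_over_def functor_cat_def)
qed

text \<open>Together with \<open>map_cone_comp\<close> this makes the image of a cone strictly
  functorial. Equality of records is essential, since sketch morphisms are tested by membership of
  the image cone in a set.\<close>

lemma map_cone_id:
  assumes "is_two_cone w S c"
  shows "map_cone w (id_two_ftr S) c = c"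
proof -
  let ?A = "Shape (w (Index c))"
  have D: "is_two_functor ?A S (Diagram c)" and X: "Apex c \<in> Obj S"
    and P: "Proj c \<in> extensional (Obj ?A)"
    using assms by (auto simp: is_two_cone_def is_two_nat_def)
  have "(\<lambda>j\<in>Obj ?A. comp_ftr (tob (Weight (w (Index c))) j)
      (thom (id_two_ftr S) (Apex c) (tob (Diagram c) j)) (Proj c j)) = Proj c"
    using P X two_functor_ob[OF D] comp_ftr_id_left[OF two_cone_proj[OF assms]]
    by (intro extensionalityI[OF restrict_extensional]) (auto simp: id_two_ftr_def)
  then show ?thesis
    using X comp_two_ftr_id_left[OF D] by (simp add: map_cone_def id_two_ftr_def)
qed

lemma map_cone_comp:
  assumes "is_two_cone w S c"
  shows "map_cone w (comp_two_ftr S G F) c = map_cone w G (map_cone w F c)"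
proof -
  let ?A = "Shape (w (Index c))"
  have D: "is_two_functor ?A S (Diagram c)" and X: "Apex c \<in> Obj S"
    using assms by (auto simp: is_two_cone_def)
  have "comp_ftr (tob (Weight (w (Index c))) j)
        (thom (comp_two_ftr S G F) (Apex c) (tob (Diagram c) j)) (Proj c j) =
      comp_ftr (tob (Weight (w (Index c))) j)
        (thom G (tob F (Apex c)) (tob (comp_two_ftr ?A F (Diagram c)) j))
        (comp_ftr (tob (Weight (w (Index c))) j) (thom F (Apex c) (tob (Diagram c) j)) (Proj c j))"
    if "j \<in> Obj ?A" for j
    using that X two_functor_ob[OF D] comp_ftr_assoc[OF two_cone_proj[OF assms]]
    by (simp add: comp_two_ftr_def)
  moreover have "tob (comp_two_ftr S G F) (Apex c) = tob G (tob F (Apex c))"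
    using X by (simp add: comp_two_ftr_def)
  ultimately show ?thesis
    by (auto simp: map_cone_def comp_two_ftr_assoc[OF D] intro!: restrict_ext)
qed

section \<open>The F-category generated by a set of cones\<close>

text \<open>The rules \<open>unit\<close> and \<open>comp\<close> are the closure conditions of an
  F-category, and \<open>diagram\<close> and \<open>proj\<close> are the two tightness conditions of
  \<open>is_F_cone_iff\<close>. Source and target are arguments because the same element may be a
  1-cell in several homs.\<close>

inductive gen_tight ::
  "'u stwo_cat \<Rightarrow> ('u F_weight, 'u) cone set \<Rightarrow> 'u \<Rightarrow> 'u \<Rightarrow> 'u \<Rightarrow> bool"
  for C :: "'u stwo_cat" and K :: "('u F_weight, 'u) cone set" where
  unit: "X \<in> Obj C \<Longrightarrow> gen_tight C K X X (Unit C X)"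
| comp: "gen_tight C K X Y f \<Longrightarrow> gen_tight C K Y Z g \<Longrightarrow> gen_tight C K X Z (comp1 C X Y Z g f)"
| diagram: "c \<in> K \<Longrightarrow> i \<in> Obj (Loose (FShape (Index c))) \<Longrightarrow> j \<in> Obj (Loose (FShape (Index c))) \<Longrightarrow>
    f \<in> Tight (FShape (Index c)) i j \<Longrightarrow>
    gen_tight C K (tob (Diagram c) i) (tob (Diagram c) j) (fob (thom (Diagram c) i j) f)"
| proj: "c \<in> K \<Longrightarrow> j \<in> Obj (Loose (FShape (Index c))) \<Longrightarrow>
    x \<in> Ob (Tau (tob (FWeight (Index c)) j)) \<Longrightarrow>
    gen_tight C K (Apex c) (tob (Diagram c) j)
      (fob (Proj c j) (fob (Emb (tob (FWeight (Index c)) j)) x))"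

definition gen_F_cat :: "'u stwo_cat \<Rightarrow> ('u F_weight, 'u) cone set \<Rightarrow> 'u sF_cat" where
  "gen_F_cat C K = \<lparr>Loose = C,
     Tight = (\<lambda>X Y. if X \<in> Obj C \<and> Y \<in> Obj C then {f. gen_tight C K X Y f} else undefined)\<rparr>"

lemma Loose_gen_F_cat [simp]: "Loose (gen_F_cat C K) = C"
  by (simp add: gen_F_cat_def)

text \<open>The cones carry F-weights, but only their loose parts are assumed to be cones: at this
  stage \<open>C\<close> has no tight 1-cells yet.\<close>

locale generating_cones =
  fixes C :: "'u stwo_cat" and K :: "('u F_weight, 'u) cone set"
  assumes two_cat: "is_two_cat C"
    and weight: "c \<in> K \<Longrightarrow> is_F_weight (Index c)"
    and cone: "c \<in> K \<Longrightarrow> is_two_cone loose_weight C c"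
begin

lemma diagram_functor: "c \<in> K \<Longrightarrow> is_two_functor (Loose (FShape (Index c))) C (Diagram c)"
  using cone[of c] by (simp add: is_two_cone_def loose_weight_def)

lemma apex: "c \<in> K \<Longrightarrow> Apex c \<in> Obj C"
  using cone[of c] by (simp add: is_two_cone_def)

lemma shape_Tight:
  assumes "c \<in> K" "i \<in> Obj (Loose (FShape (Index c)))" "j \<in> Obj (Loose (FShape (Index c)))"
    "f \<in> Tight (FShape (Index c)) i j"
  shows "f \<in> Ob (Hom (Loose (FShape (Index c))) i j)"
  using F_cat_Tight[of "FShape (Index c)" i j] weight[of c] assms by (auto simp: is_F_weight_def)

lemma Emb_weight:
  assumes "c \<in> K" "j \<in> Obj (Loose (FShape (Index c)))" "x \<in> Ob (Tau (tob (FWeight (Index c)) j))"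
  shows "fob (Emb (tob (FWeight (Index c)) j)) x \<in> Ob (Lam (tob (FWeight (Index c)) j))"
proof -
  have "is_two_functor (Loose (FShape (Index c))) (Loose F_CAT) (FWeight (Index c))"
    using weight[of c] assms by (simp add: is_F_weight_def is_F_functor_def)
  from two_functor_ob[OF this assms(2)] have "is_F_obj (tob (FWeight (Index c)) j)"
    by (simp add: Loose_F_CAT cat_over_def)
  then show ?thesis
    using functor_ob assms(3) by (auto simp: is_F_obj_def)
qed

lemma proj_functor:
  assumes "c \<in> K" "j \<in> Obj (Loose (FShape (Index c)))"
  shows "is_functor (Lam (tob (FWeight (Index c)) j)) (Hom C (Apex c) (tob (Diagram c) j)) (Proj c j)"
  using two_cone_proj[OF cone[OF assms(1)], of j] assms(2) by (simp add: loose_weight_def)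

text \<open>The generated cells get their types from the cones: tight 1-cells of a shape are loose
  ones, which the diagram maps into \<open>C\<close>, and \<open>Emb\<close> sends tight objects of
  the weight into the domain of the projection functor.\<close>

lemma gen_tight_loose:
  assumes "gen_tight C K X Y f"
  shows "X \<in> Obj C \<and> Y \<in> Obj C \<and> f \<in> Ob (Hom C X Y)"
  using assms
proof induction
  case (diagram c i j f)
  then show ?case
    using two_functor_ob[OF diagram_functor] shape_Tight
      functor_ob[OF two_functor_functor[OF diagram_functor]] by simp
next
  case (proj c j x)
  then show ?case
    using two_functor_ob[OF diagram_functor] apex functor_ob[OF proj_functor Emb_weight] by simp
qed (use two_cat_unit[OF two_cat] two_cat_comp[OF two_cat] in auto)

lemma Tight_gen_F_cat:
  "X \<in> Obj C \<Longrightarrow> Y \<in> Obj C \<Longrightarrow> f \<in> Tight (gen_F_cat C K) X Y \<longleftrightarrow> gen_tight C K X Y f"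
  by (simp add: gen_F_cat_def)

lemma is_F_cat_gen_F_cat: "is_F_cat (gen_F_cat C K)"
  unfolding is_F_cat_def using two_cat gen_tight_loose
  by (auto simp: Tight_gen_F_cat intro: gen_tight.unit gen_tight.comp) (auto simp: gen_F_cat_def)

lemma is_F_cone_gen_F_cat: "c \<in> K \<Longrightarrow> is_F_cone (gen_F_cat C K) c"
  using two_functor_ob[OF diagram_functor] apex
  by (auto simp: is_F_cone_iff[OF is_F_cat_gen_F_cat weight] cone Tight_gen_F_cat
      intro: gen_tight.diagram gen_tight.proj)

text \<open>Universal property of the generated tight cells. The 1-cells that \<open>F\<close> sends
  to tight ones contain the units, are closed under composition and contain the generators, because
  the image cones are F-cones in \<open>T\<close>; so they contain the least such class.\<close>

lemma is_F_functor_gen_F_cat_iff: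
  assumes T: "is_F_cat T" and cones: "\<And>c. c \<in> K \<Longrightarrow> is_F_cone T (map_cone loose_weight F c)"
  shows "is_F_functor (gen_F_cat C K) T F \<longleftrightarrow> is_two_functor C (Loose T) F"
proof -
  have "fob (thom F X Y) f \<in> Tight T (tob F X) (tob F Y)"
    if F: "is_two_functor C (Loose T) F" and f: "gen_tight C K X Y f" for X Y f
    using f
  proof induction
    case (unit X)
    then show ?case
      using two_functor_unit[OF F] two_functor_ob[OF F] F_cat_Tight_unit[OF T] by simp
  next
    case (comp X Y f Z g)
    note gen_tight_loose[OF comp.hyps(1)] gen_tight_loose[OF comp.hyps(2)]
    with comp.IH show ?case
      using two_functor_comp1[OF F] two_functor_ob[OF F] F_cat_Tight_comp[OF T] by simp
  next
    case (diagram c i j f)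
    let ?c = "map_cone loose_weight F c"
    have "is_F_weight (Index ?c)"
      using weight[OF diagram(1)] by (simp add: map_cone_def)
    \<comment> \<open>The diagram of the image cone is \<open>F\<close> after the given diagram, so
      its tightness condition in \<open>T\<close> is the claim.\<close>
    then have "fob (thom (Diagram ?c) i j) f \<in> Tight T (tob (Diagram ?c) i) (tob (Diagram ?c) j)"
      using cones[OF diagram(1)] diagram by (simp add: is_F_cone_iff[OF T]) (simp add: map_cone_def)
    then show ?case
      using diagram shape_Tight[OF diagram]
      by (simp add: map_cone_def comp_two_ftr_def comp_ftr_def loose_weight_def)
  next
    case (proj c j x)
    let ?c = "map_cone loose_weight F c"
    have "is_F_weight (Index ?c)"
      using weight[OF proj(1)] by (simp add: map_cone_def)
    then have "fob (Proj ?c j) (fob (Emb (tob (FWeight (Index c)) j)) x)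
        \<in> Tight T (Apex ?c) (tob (Diagram ?c) j)"
      using cones[OF proj(1)] proj by (simp add: is_F_cone_iff[OF T]) (simp add: map_cone_def)
    then show ?case
      using proj Emb_weight[OF proj]
      by (simp add: map_cone_def comp_two_ftr_def comp_ftr_def loose_weight_def)
  qed
  then show ?thesis
    by (auto simp: is_F_functor_def Tight_gen_F_cat)
qed

end

section \<open>Categories of sketches\<close>

lemma Ob_sketch_cat [simp]: "Ob (sketch_cat K mor B) = K"
  by (simp add: sketch_cat_def Let_def)

lemma Ar_sketch_cat [simp]:
  "(S, F, T) \<in> Ar (sketch_cat K mor B) \<longleftrightarrow> S \<in> K \<and> T \<in> K \<and> mor S T F"
  by (simp add: sketch_cat_def Let_def)

lemma Src_sketch_cat [simp]:
  "(S, F, T) \<in> Ar (sketch_cat K mor B) \<Longrightarrow> Src (sketch_cat K mor B) (S, F, T) = S"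
  by (simp add: sketch_cat_def Let_def)

lemma Tgt_sketch_cat [simp]:
  "(S, F, T) \<in> Ar (sketch_cat K mor B) \<Longrightarrow> Tgt (sketch_cat K mor B) (S, F, T) = T"
  by (simp add: sketch_cat_def Let_def)

lemma Ident_sketch_cat [simp]:
  "S \<in> K \<Longrightarrow> Ident (sketch_cat K mor B) S = (S, id_two_ftr (B S), S)"
  by (simp add: sketch_cat_def Let_def)

lemma Cmp_sketch_cat [simp]:
  "(S, F, T) \<in> Ar (sketch_cat K mor B) \<Longrightarrow> (T, G, R) \<in> Ar (sketch_cat K mor B) \<Longrightarrow>
    Cmp (sketch_cat K mor B) (T, G, R) (S, F, T) = (S, comp_two_ftr (B S) G F, R)"
  by (simp add: sketch_cat_def Let_def)

lemma hom_sketch_cat: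
  "hom (sketch_cat K mor B) S T = {(S', F, T'). S' = S \<and> T' = T \<and> S \<in> K \<and> T \<in> K \<and> mor S T F}"
  by (auto simp: hom_def)

text \<open>Stated for an arbitrary \<open>mor\<close>, so that 2-sketches and F-sketches are both
  instances. The category laws are those of strict composition of 2-functors.\<close>

lemma is_category_sketch_cat:
  assumes id: "\<And>S. S \<in> K \<Longrightarrow> mor S S (id_two_ftr (B S))"
    and comp: "\<And>S T R F G. S \<in> K \<Longrightarrow> T \<in> K \<Longrightarrow> R \<in> K \<Longrightarrow> mor S T F \<Longrightarrow> mor T R G \<Longrightarrow>
      mor S R (comp_two_ftr (B S) G F)"
    and two_functor: "\<And>S T F. S \<in> K \<Longrightarrow> T \<in> K \<Longrightarrow> mor S T F \<Longrightarrow> is_two_functor (B S) (B T) F"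
  shows "is_category (sketch_cat K mor B)"
proof -
  let ?C = "sketch_cat K mor B"
  have "Src ?C \<in> Ar ?C \<rightarrow>\<^sub>E Ob ?C" "Tgt ?C \<in> Ar ?C \<rightarrow>\<^sub>E Ob ?C" "Ident ?C \<in> extensional (Ob ?C)"
    by (auto simp: sketch_cat_def Let_def)
  moreover have "Ident ?C S \<in> hom ?C S S" if "S \<in> Ob ?C" for S
    using that id by (simp add: hom_sketch_cat)
  moreover have "Cmp ?C g f \<in> hom ?C (Src ?C f) (Tgt ?C g)"
    if "f \<in> Ar ?C" "g \<in> Ar ?C" "Tgt ?C f = Src ?C g" for f g
    using that comp by (cases f; cases g) (auto simp: hom_sketch_cat)
  moreover have "Cmp ?C g f = undefined"
    if "\<not> (f \<in> Ar ?C \<and> g \<in> Ar ?C \<and> Tgt ?C f = Src ?C g)" for f g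
    using that by (cases f; cases g) (auto simp: sketch_cat_def Let_def)
  moreover have "Cmp ?C f (Ident ?C (Src ?C f)) = f \<and> Cmp ?C (Ident ?C (Tgt ?C f)) f = f"
    if "f \<in> Ar ?C" for f
    using that id
    by (cases f) (auto simp: comp_two_ftr_id_left[OF two_functor] comp_two_ftr_id_right[OF two_functor])
  moreover have "Cmp ?C h (Cmp ?C g f) = Cmp ?C (Cmp ?C h g) f"
    if "f \<in> Ar ?C" "g \<in> Ar ?C" "h \<in> Ar ?C" "Tgt ?C f = Src ?C g" "Tgt ?C g = Src ?C h" for f g h
  proof -
    obtain S F T T' G R R' H Q where *: "f = (S, F, T)" "g = (T', G, R)" "h = (R', H, Q)"
      by (cases f; cases g; cases h)
    then have "T' = T" "R' = R" "S \<in> K" "T \<in> K" "R \<in> K" "Q \<in> K" "mor S T F" "mor T R G" "mor R Q H"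
      using that by auto
    with * show ?thesis
      using comp[of S T R F G] comp[of T R Q G H]
      by (simp add: comp_two_ftr_assoc[OF two_functor[of S T F]])
  qed
  ultimately show ?thesis
    unfolding is_category_def by blast
qed

section \<open>The two instances: 2-sketches and F-sketches\<close>

lemma is_two_sketch_mor_id: "is_two_sketch I w S \<Longrightarrow> is_two_sketch_mor w S S (id_two_ftr (Base S))"
  by (auto simp: is_two_sketch_def is_two_sketch_mor_def is_two_functor_id map_cone_id)

lemma is_two_sketch_mor_comp:
  assumes "is_two_sketch I w S" "is_two_sketch_mor w S T F" "is_two_sketch_mor w T R G"
  shows "is_two_sketch_mor w S R (comp_two_ftr (Base S) G F)"
  using assms
  by (auto simp: is_two_sketch_def is_two_sketch_mor_def map_cone_comp intro: is_two_functor_comp)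

lemma is_category_two_SK: "is_category (two_SK I w)"
  unfolding two_SK_def
  by (rule is_category_sketch_cat)
    (auto intro: is_two_sketch_mor_id is_two_sketch_mor_comp, simp add: is_two_sketch_mor_def)

lemma is_F_functor_id: "is_F_cat A \<Longrightarrow> is_F_functor A A (id_two_ftr (Loose A))"
  using F_cat_Tight[of A] is_two_functor_id[OF F_cat_two_cat[of A]]
  by (simp add: is_F_functor_def) (auto simp: id_two_ftr_def id_ftr_def)

lemma is_F_functor_comp:
  assumes A: "is_F_cat A" and F: "is_F_functor A B F" and G: "is_F_functor B C G"
  shows "is_F_functor A C (comp_two_ftr (Loose A) G F)"
proof -
  have F2: "is_two_functor (Loose A) (Loose B) F" and G2: "is_two_functor (Loose B) (Loose C) G"
    using F G by (simp_all add: is_F_functor_def)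
  show ?thesis
    unfolding is_F_functor_def
    using is_two_functor_comp[OF F_cat_two_cat[OF A] F2 G2] F G F_cat_Tight[OF A] two_functor_ob[OF F2]
    by (auto simp: comp_two_ftr_def comp_ftr_def is_F_functor_def subset_iff)
qed

lemma is_F_sketch_mor_id: "is_F_sketch \<Psi> S \<Longrightarrow> is_F_sketch_mor S S (id_two_ftr (Loose (Base S)))"
  by (auto simp: is_F_sketch_def is_F_sketch_mor_def is_F_functor_id map_cone_id[OF F_cone_two_cone])

lemma is_F_sketch_mor_comp:
  assumes "is_F_sketch \<Psi> S" "is_F_sketch_mor S T F" "is_F_sketch_mor T R G"
  shows "is_F_sketch_mor S R (comp_two_ftr (Loose (Base S)) G F)"
  using assms
  by (auto simp: is_F_sketch_def is_F_sketch_mor_def map_cone_comp[OF F_cone_two_cone]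
      intro: is_F_functor_comp)

lemma is_category_F_SK: "is_category (F_SK \<Psi>)"
  unfolding F_SK_def
  by (rule is_category_sketch_cat)
    (auto intro: is_F_sketch_mor_id is_F_sketch_mor_comp,
      simp add: is_F_sketch_mor_def is_F_functor_def)

section \<open>The adjunction\<close>

text \<open>Here \<open>s\<close> chooses an F-weight for each index. The other fields can stay
  because F-functors and F-natural transformations are represented by their loose parts.\<close>

definition lift_cone :: "('i \<Rightarrow> 'u F_weight) \<Rightarrow> ('i, 'u) cone \<Rightarrow> ('u F_weight, 'u) cone" where
  "lift_cone s c = \<lparr>Index = s (Index c), Diagram = Diagram c, Apex = Apex c, Proj = Proj c\<rparr>"

definition lift_sketch :: "('i \<Rightarrow> 'u F_weight) \<Rightarrow> ('i, 'u) two_sketch \<Rightarrow> 'u F_sketch" where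
  "lift_sketch s S =
    \<lparr>Base = gen_F_cat (Base S) (lift_cone s ` Cones S), Cones = lift_cone s ` Cones S\<rparr>"

lemma Loose_Base_lift_sketch [simp]: "Loose (Base (lift_sketch s S)) = Base S"
  by (simp add: lift_sketch_def)

lemma Base_loose_sketch [simp]: "Base (loose_sketch r S) = Loose (Base S)"
  by (simp add: loose_sketch_def)

text \<open>
  The two readings of the class of loose parts differ only in how an F-weight is turned into
  an index of a 2-weight, so both are instances of the following situation.
\<close>

locale loose_indexing =
  fixes \<Psi> :: "'u F_weight set" and r :: "'u F_weight \<Rightarrow> 'i" and w :: "'i \<Rightarrow> 'u two_weight"
  assumes weights: "W \<in> \<Psi> \<Longrightarrow> is_F_weight W"
    and inj: "inj_on r \<Psi>"
    and w_r: "W \<in> \<Psi> \<Longrightarrow> w (r W) = loose_weight W"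
begin

abbreviation "s \<equiv> inv_into \<Psi> r"
abbreviation "FS \<equiv> F_SK \<Psi>"
abbreviation "TS \<equiv> two_SK (r ` \<Psi>) w"
abbreviation "U \<equiv> loose_functor \<Psi> r"

lemma loose_lift_cone: "Index c \<in> r ` \<Psi> \<Longrightarrow> loose_cone r (lift_cone s c) = c"
  by (simp add: loose_cone_def lift_cone_def f_inv_into_f)

text \<open>Injectivity of \<open>r\<close> enters here: the F-weight of a cone can be recovered
  from its index.\<close>

lemma lift_loose_cone: "Index c \<in> \<Psi> \<Longrightarrow> lift_cone s (loose_cone r c) = c"
  by (simp add: loose_cone_def lift_cone_def inv_into_f_f[OF inj])

text \<open>\<open>map_cone\<close> sees the weight only through its loose part, which
  \<open>w_r\<close> identifies on the two sides.\<close>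

lemma map_loose_cone:
  "Index c \<in> \<Psi> \<Longrightarrow> map_cone w F (loose_cone r c) = loose_cone r (map_cone loose_weight F c)"
  by (simp add: map_cone_def loose_cone_def w_r)

lemma two_cone_loose_iff:
  "Index c \<in> \<Psi> \<Longrightarrow> is_two_cone w S (loose_cone r c) \<longleftrightarrow> is_two_cone loose_weight S c"
  by (simp add: is_two_cone_def loose_cone_def w_r)

lemma lift_cones:
  assumes "is_two_sketch (r ` \<Psi>) w S" "c \<in> lift_cone s ` Cones S"
  shows "Index c \<in> \<Psi>" "loose_cone r c \<in> Cones S" "is_two_cone loose_weight (Base S) c"
proof -
  obtain d where d: "d \<in> Cones S" "c = lift_cone s d" "Index d \<in> r ` \<Psi>"
    using assms by (auto simp: is_two_sketch_def)
  then show I: "Index c \<in> \<Psi>" "loose_cone r c \<in> Cones S"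
    by (simp_all add: loose_lift_cone) (simp add: lift_cone_def inv_into_into)
  then show "is_two_cone loose_weight (Base S) c"
    using assms(1) two_cone_loose_iff by (auto simp: is_two_sketch_def)
qed

lemma generating_cones_lift:
  assumes "is_two_sketch (r ` \<Psi>) w S"
  shows "generating_cones (Base S) (lift_cone s ` Cones S)"
  using assms lift_cones[OF assms] weights by unfold_locales (auto simp: is_two_sketch_def)

lemma is_F_sketch_lift: "is_two_sketch (r ` \<Psi>) w S \<Longrightarrow> is_F_sketch \<Psi> (lift_sketch s S)"
  using lift_cones generating_cones.is_F_cat_gen_F_cat[OF generating_cones_lift]
    generating_cones.is_F_cone_gen_F_cat[OF generating_cones_lift]
  by (auto simp: is_F_sketch_def lift_sketch_def)

lemma loose_lift_sketch: "is_two_sketch (r ` \<Psi>) w S \<Longrightarrow> loose_sketch r (lift_sketch s S) = S"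
  by (cases S) (auto simp: loose_sketch_def lift_sketch_def image_image is_two_sketch_def loose_lift_cone)

lemma is_two_sketch_loose: "is_F_sketch \<Psi> S \<Longrightarrow> is_two_sketch (r ` \<Psi>) w (loose_sketch r S)"
  by (auto simp: is_F_sketch_def is_two_sketch_def loose_sketch_def F_cat_two_cat
      two_cone_loose_iff F_cone_two_cone) (simp add: loose_cone_def)

lemma is_two_sketch_mor_loose:
  assumes "is_F_sketch \<Psi> S" "is_F_sketch_mor S T F"
  shows "is_two_sketch_mor w (loose_sketch r S) (loose_sketch r T) F"
  using assms
  by (auto simp: is_F_sketch_mor_def is_two_sketch_mor_def is_F_functor_def is_F_sketch_def
      loose_sketch_def map_loose_cone)

text \<open>This is the hom bijection of the adjunction: the same 2-functor is a morphism on either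
  side. Left to right forgets tightness; right to left is the universal property of the generated
  tight cells.\<close>

lemma is_F_sketch_mor_lift_iff:
  assumes S: "is_two_sketch (r ` \<Psi>) w S" and T: "is_F_sketch \<Psi> T"
  shows "is_F_sketch_mor (lift_sketch s S) T F \<longleftrightarrow> is_two_sketch_mor w S (loose_sketch r T) F"
proof
  assume "is_F_sketch_mor (lift_sketch s S) T F"
  then show "is_two_sketch_mor w S (loose_sketch r T) F"
    using is_two_sketch_mor_loose[OF is_F_sketch_lift[OF S]] loose_lift_sketch[OF S] by simp
next
  assume F: "is_two_sketch_mor w S (loose_sketch r T) F"
  have cones: "map_cone loose_weight F c \<in> Cones T" if c: "c \<in> lift_cone s ` Cones S" for c
  proof -
    have I: "Index c \<in> \<Psi>" "Index (map_cone loose_weight F c) \<in> \<Psi>"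
      using lift_cones(1)[OF S c] by (simp_all add: map_cone_def)
    have "loose_cone r (map_cone loose_weight F c) \<in> loose_cone r ` Cones T"
      using F lift_cones(2)[OF S c]
      by (simp add: is_two_sketch_mor_def loose_sketch_def map_loose_cone[OF I(1), symmetric])
    then obtain d where d: "d \<in> Cones T" "loose_cone r d = loose_cone r (map_cone loose_weight F c)"
      by auto
    \<comment> \<open>By \<open>lift_loose_cone\<close>, \<open>loose_cone r\<close> is injective on
      cones with weight in \<open>\<Psi>\<close>.\<close>
    then have "d = map_cone loose_weight F c"
      using T I(2) lift_loose_cone by (metis is_F_sketch_def)
    then show ?thesis
      using d(1) by simp
  qed
  interpret generating_cones "Base S" "lift_cone s ` Cones S"
    by (rule generating_cones_lift[OF S])
  \<comment> \<open>Specified cones of \<open>T\<close> are F-cones, so the universal property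
    applies to \<open>F\<close>.\<close>
  have "is_F_functor (gen_F_cat (Base S) (lift_cone s ` Cones S)) (Base T) F"
    using T F cones
    by (subst is_F_functor_gen_F_cat_iff) (auto simp: is_F_sketch_def is_two_sketch_mor_def)
  then show "is_F_sketch_mor (lift_sketch s S) T F"
    using cones by (simp add: is_F_sketch_mor_def lift_sketch_def)
qed

section \<open>The lifting functor, its full faithfulness and the adjunction\<close>

definition lift_functor where
  "lift_functor =
    \<lparr>fob = (\<lambda>S\<in>Ob TS. lift_sketch s S),
     far = (\<lambda>(S, F, T)\<in>Ar TS. (lift_sketch s S, F, lift_sketch s T))\<rparr>"

lemmas SK_defs = two_SK_def F_SK_def lift_functor_def loose_functor_def

text \<open>On morphisms, \<open>is_F_sketch_mor_lift_iff\<close> is used with target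
  \<open>lift_sketch s T\<close>, whose loose part is \<open>T\<close> again by
  \<open>loose_lift_sketch\<close>. The same argument gives full faithfulness below.\<close>

lemma is_functor_lift: "is_functor TS FS lift_functor"
  unfolding is_functor_def using is_category_two_SK is_category_F_SK
  by (auto simp: SK_defs is_F_sketch_mor_lift_iff is_F_sketch_lift loose_lift_sketch
      is_two_sketch_mor_id is_two_sketch_mor_comp)

lemma is_functor_loose: "is_functor FS TS U"
  unfolding is_functor_def using is_category_two_SK is_category_F_SK
  by (auto simp: SK_defs is_two_sketch_loose is_two_sketch_mor_loose
      is_F_sketch_mor_id is_F_sketch_mor_comp)

lemma fully_faithful_lift: "fully_faithful TS FS lift_functor"
  unfolding fully_faithful_def
proof (intro ballI)
  fix S T assume ST: "S \<in> Ob TS" "T \<in> Ob TS"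
  show "bij_betw (far lift_functor) (hom TS S T) (hom FS (fob lift_functor S) (fob lift_functor T))"
    by (rule bij_betw_byWitness[where f' = "\<lambda>(_, F, _). (S, F, T)"])
      (use ST in \<open>auto simp: SK_defs hom_sketch_cat is_F_sketch_mor_lift_iff loose_lift_sketch is_F_sketch_lift\<close>)
qed

lemma is_left_adjoint_lift: "is_left_adjoint FS TS lift_functor U"
  unfolding is_left_adjoint_def
\<comment> \<open>The adjunction bijection keeps the 2-functor and only replaces the source and
  target recorded in the arrow.\<close>
proof (intro conjI is_functor_lift is_functor_loose
    exI[where x = "\<lambda>S T (_, F, _). (S, F, fob U T)"] ballI)
  fix S T assume ST: "S \<in> Ob TS" "T \<in> Ob FS"
  show "bij_betw (\<lambda>(_, F, _). (S, F, fob U T)) (hom FS (fob lift_functor S) T) (hom TS S (fob U T))"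
    by (rule bij_betw_byWitness[where f' = "\<lambda>(_, F, _). (fob lift_functor S, F, T)"])
      (use ST in \<open>auto simp: SK_defs hom_sketch_cat is_F_sketch_mor_lift_iff is_F_sketch_lift
        is_two_sketch_loose\<close>)
next
  fix S T f T' h
  assume "S \<in> Ob TS" "T \<in> Ob FS" "f \<in> hom FS (fob lift_functor S) T" "T' \<in> Ob FS" "h \<in> hom FS T T'"
  \<comment> \<open>Both sides contain the same composite 2-functor, because
    \<open>lift_sketch s S\<close> and \<open>S\<close> have the same underlying 2-category.\<close>
  then show "(\<lambda>(_, F, _). (S, F, fob U T')) (Cmp FS h f) =
      Cmp TS (far U h) ((\<lambda>(_, F, _). (S, F, fob U T)) f)"
    by (auto simp: SK_defs hom_sketch_cat is_F_sketch_mor_lift_iff is_F_sketch_lift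
        is_two_sketch_loose is_two_sketch_mor_loose)
next
  fix S T f S' g
  assume "S \<in> Ob TS" "T \<in> Ob FS" "f \<in> hom FS (fob lift_functor S) T" "S' \<in> Ob TS" "g \<in> hom TS S' S"
  then show "(\<lambda>(_, F, _). (S', F, fob U T)) (Cmp FS f (far lift_functor g)) =
      Cmp TS ((\<lambda>(_, F, _). (S, F, fob U T)) f) g"
    by (auto simp: SK_defs hom_sketch_cat is_F_sketch_mor_lift_iff is_F_sketch_lift
        is_two_sketch_loose loose_lift_sketch)
qed

lemma has_coreflective_left_adjoint: "has_coreflective_left_adjoint FS TS U"
  unfolding has_coreflective_left_adjoint_def using is_left_adjoint_lift fully_faithful_lift by blast

end

theorem theorem8p2:
  fixes \<Psi> :: "'u F_weight set"
  assumes "\<Psi> \<subseteq> {W. is_F_weight W}"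
  shows "has_coreflective_left_adjoint (F_SK \<Psi>) (SK_indexed \<Psi>) (loose_functor_indexed \<Psi>) \<and>
    (inj_on loose_weight \<Psi> \<longrightarrow>
      has_coreflective_left_adjoint (F_SK \<Psi>) (SK_plain \<Psi>) (loose_functor_plain \<Psi>))"
proof (intro conjI impI)
  \<comment> \<open>Indexed reading: an index is the F-weight itself, so injectivity of the indexing
    is automatic.\<close>
  interpret loose_indexing \<Psi> "\<lambda>W. W" loose_weight
    using assms by unfold_locales (auto simp: inj_on_def)
  show "has_coreflective_left_adjoint (F_SK \<Psi>) (SK_indexed \<Psi>) (loose_functor_indexed \<Psi>)"
    \<comment> \<open>The locale states the result for the image of \<open>\<Psi>\<close> under the
      identity, which simplifies to \<open>\<Psi>\<close>.\<close>
    using has_coreflective_left_adjoint by simp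
next
  assume "inj_on loose_weight \<Psi>"
  \<comment> \<open>Plain reading: an index is the loose weight itself, and the assumed injectivity
    is what the locale requires.\<close>
  then interpret loose_indexing \<Psi> loose_weight "\<lambda>V. V"
    using assms by unfold_locales auto
  show "has_coreflective_left_adjoint (F_SK \<Psi>) (SK_plain \<Psi>) (loose_functor_plain \<Psi>)"
    by (rule has_coreflective_left_adjoint)
qed

end
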